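(* Let $n\ge1$. For any $\chi\ge1$ and any $\kappa_b\ge1$ there exist a constant $\kappa_s>0$ and a decentralized problem, consisting of a number of nodes $m$, a time-varying network $\{\mathcal G^k\}$ on $m$ nodes with gossip matrices $\{W(k)\}$ satisfying the gossip assumption with constant $\chi$ (see context), and functions $f_{ij}$ with $F_i=\frac1n\sum_{j=1}^nf_{ij}$ defined on a (possibly infinite-dimensional) Hilbert space, such that each $f_{ij}$ is convex and $L_{ij}$-smooth, each $F_i$ is $\mu_i$-strongly convex and $L_i$-smooth, $\kappa_b\ge L_i/\mu_i$ and $\kappa_s\ge\frac1n\sum_{j=1}^nL_{ij}/\mu_i$ for all $i$, and such that for any first-order decentralized algorithm (see context), for each node to reach an $\varepsilon$-solution of $\min_x\sum_{i=1}^mF_i(x)$, a minimum of $N_c$ communication iterations and $N_s$ stochastic oracle calls on some node are required, where $$N_s=\Omega\left(\left(n+\sqrt{n\kappa_s}\right)\log\frac1\varepsilon\right),\qquad N_c=\Omega\left(\chi\sqrt{\kappa_b}\,\log\frac1\varepsilon\right).$$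
   Context: Definitions. $g$ is $\ell$-smooth if $\|\nabla g(u)-\nabla g(v)\|\le\ell\|u-v\|$, and $\mu$-strongly convex if $g(v)\ge g(u)+\langle\nabla g(u),v-u\rangle+\frac\mu2\|v-u\|^2$. An $\varepsilon$-solution is a point $x$ with $\|x-x^\star\|^2\le\varepsilon\|x^0-x^\star\|^2$, where $x^\star$ is the minimizer and $x^0=0$ the starting point. Gossip assumption with constant $\chi\ge1$: for every $k$ (with $E$ the space on which the problem is posed): (1) $[W(k)]_{ij}\ne0$ iff $(i,j)$ is an edge of $\mathcal G^k$ or $i=j$; (2) $\ker W(k)\supset\{(c,\dots,c):c\in\mathbb R\}$; (3) $\mathrm{range}\,W(k)\subset\{a\in\mathbb R^m:\sum_ia_i=0\}$; (4) $\|(W(k)\otimes I)x-x\|^2\le(1-\chi^{-1})\|x\|^2$ for all $x\in E^m$ with $\sum_ix_i=0$. First-order decentralized algorithm: time is discrete, and each step is either communicational or computational. Node $i$ has local memory $\mathcal H_i(k)$ at step $k$, with $\mathcal H_i(0)=\{0\}$, and its output belongs to its memory. If step $k$ is computational, $\mathcal H_i(k+1)\subseteq\mathrm{span}\big(\bigcup_{j=1}^n\{x,\nabla f_{ij}(x),\nabla f_{ij}^*(x):x\in\mathcal H_i(k)\}\big)$ for all $i$, where $f^*$ is the convex conjugate. If step $k$ is communicational, $\mathcal H_i(k+1)\subseteq\mathrm{span}\big(\bigcup_{j\in\mathcal N_i^k}\mathcal H_j(k)\cup\mathcal H_i(k)\big)$, where $\mathcal N_i^k$ is the set of neighbours of $i$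 in $\mathcal G^k$; one graph of the sequence is used per communicational step. A stochastic oracle call on node $i$ is one evaluation of $\nabla f_{ij}$ or $\nabla f_{ij}^*$ for a single index $j$ at a single point. Convention: $\Omega(\cdot)$ hides an absolute positive constant and is understood asymptotically, i.e. for $\chi$ and $\kappa_b$ larger than absolute constants and $\varepsilon$ smaller than an absolute constant. *)

theory Defs
  imports "HOL-Analysis.Analysis"
begin

text \<open>
  HOL cannot quantify existentially over types, so the Hilbert space carrying the problem is
  fixed to be the space of square-summable real sequences.
\<close>
typedef ell2 = "{x :: nat \<Rightarrow> real. summable (\<lambda>i. (x i)\<^sup>2)}"
  morphisms coord Abs_ell2
  by (rule exI[of _ "\<lambda>_. 0"]) simp

lemma summable_coord_sq: "summable (\<lambda>i. (coord x i)\<^sup>2)"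
  using coord[of x] by simp

lemma coord_Abs: "summable (\<lambda>i. (f i)\<^sup>2) \<Longrightarrow> coord (Abs_ell2 f) = f"
  by (simp add: Abs_ell2_inverse)

lemma ell2_eqI: "(\<And>i. coord x i = coord y i) \<Longrightarrow> x = y"
  by (metis coord_inject ext)

lemma summable_mult_of_sq:
  fixes f g :: "nat \<Rightarrow> real"
  assumes "summable (\<lambda>i. (f i)\<^sup>2)" "summable (\<lambda>i. (g i)\<^sup>2)"
  shows "summable (\<lambda>i. f i * g i)"
proof (rule summable_comparison_test'[where N = 0])
  show "summable (\<lambda>i. (f i)\<^sup>2 + (g i)\<^sup>2)"
    using assms by (rule summable_add)
  fix i :: nat
  have "0 \<le> (\<bar>f i\<bar> - \<bar>g i\<bar>)\<^sup>2" by simp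
  then have "2 * (\<bar>f i\<bar> * \<bar>g i\<bar>) \<le> (f i)\<^sup>2 + (g i)\<^sup>2"
    by (simp add: power2_diff)
  moreover have "0 \<le> \<bar>f i\<bar> * \<bar>g i\<bar>" by simp
  ultimately show "norm (f i * g i) \<le> (f i)\<^sup>2 + (g i)\<^sup>2"
    unfolding real_norm_def abs_mult by linarith
qed

lemma summable_coord_mult: "summable (\<lambda>i. coord x i * coord y i)"
  by (intro summable_mult_of_sq summable_coord_sq)

lemma summable_sq_add:
  fixes f g :: "nat \<Rightarrow> real"
  assumes "summable (\<lambda>i. (f i)\<^sup>2)" "summable (\<lambda>i. (g i)\<^sup>2)"
  shows "summable (\<lambda>i. (f i + g i)\<^sup>2)"
proof -
  have "summable (\<lambda>i. (f i)\<^sup>2 + (g i)\<^sup>2 + 2 * (f i * g i))"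
    using assms by (intro summable_add summable_mult summable_mult_of_sq)
  then show ?thesis by (simp add: power2_sum algebra_simps)
qed

lemma summable_sq_scale:
  fixes f :: "nat \<Rightarrow> real"
  assumes "summable (\<lambda>i. (f i)\<^sup>2)"
  shows "summable (\<lambda>i. (c * f i)\<^sup>2)"
  using summable_mult[OF assms, of "c\<^sup>2"] by (simp add: power_mult_distrib)

instantiation ell2 :: real_inner
begin

definition "0 = Abs_ell2 (\<lambda>_. 0)"
definition "x + y = Abs_ell2 (\<lambda>i. coord x i + coord y i)"
definition "- x = Abs_ell2 (\<lambda>i. - coord x i)"
definition "x - (y::ell2) = x + (- y)"
definition "scaleR c x = Abs_ell2 (\<lambda>i. c * coord x i)"
definition "inner x y = (\<Sum>i. coord x i * coord y i)"
definition "norm (x::ell2) = sqrt (inner x x)"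
definition "sgn (x::ell2) = scaleR (inverse (norm x)) x"
definition "dist x (y::ell2) = norm (x - y)"
definition "uniformity = (INF e\<in>{0<..}. principal {(x::ell2, y). dist x y < e})"
definition "open (U::ell2 set) \<longleftrightarrow> (\<forall>x\<in>U. \<forall>\<^sub>F (x', y) in uniformity. x' = x \<longrightarrow> y \<in> U)"

lemma coord_zero: "coord 0 i = 0"
  by (simp add: zero_ell2_def coord_Abs)

lemma coord_add: "coord (x + y) i = coord x i + coord y i"
  by (simp add: plus_ell2_def coord_Abs summable_sq_add summable_coord_sq)

lemma coord_uminus: "coord (- x) i = - coord x i"
  by (simp add: uminus_ell2_def coord_Abs summable_coord_sq)

lemma coord_diff: "coord (x - y) i = coord x i - coord y i"
  by (simp add: minus_ell2_def coord_add coord_uminus)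

lemma coord_scaleR: "coord (scaleR c x) i = c * coord x i"
  by (simp add: scaleR_ell2_def coord_Abs summable_sq_scale summable_coord_sq)

lemmas coord_simps = coord_zero coord_add coord_uminus coord_diff coord_scaleR

instance
proof
  fix x y z :: ell2 and a b r :: real
  show "x + y + z = x + (y + z)" "x + y = y + x" "0 + x = x" "- x + x = 0" "x - y = x + - y"
    "a *\<^sub>R (x + y) = a *\<^sub>R x + a *\<^sub>R y" "(a + b) *\<^sub>R x = a *\<^sub>R x + b *\<^sub>R x"
    "a *\<^sub>R b *\<^sub>R x = (a * b) *\<^sub>R x" "1 *\<^sub>R x = x"
    by (auto intro!: ell2_eqI simp: coord_simps algebra_simps)
  show "inner x y = inner y x"
    by (simp add: inner_ell2_def mult.commute)
  show "inner (x + y) z = inner x z + inner y z"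
    by (simp add: inner_ell2_def coord_simps distrib_right suminf_add[symmetric] summable_coord_mult)
  show "inner (r *\<^sub>R x) y = r * inner x y"
    by (simp add: inner_ell2_def coord_simps mult.assoc suminf_mult summable_coord_mult)
  show "0 \<le> inner x x"
    by (simp add: inner_ell2_def suminf_nonneg summable_coord_mult)
  show "(inner x x = 0) = (x = 0)"
  proof -
    have "inner x x = 0 \<longleftrightarrow> (\<forall>i. coord x i * coord x i = 0)"
      unfolding inner_ell2_def by (rule suminf_eq_zero_iff) (auto simp: summable_coord_mult)
    also have "\<dots> \<longleftrightarrow> x = 0"
      by (auto intro!: ell2_eqI simp: coord_simps)
    finally show ?thesis .
  qed
qed (simp_all add: norm_ell2_def sgn_ell2_def dist_ell2_def uniformity_ell2_def open_ell2_def)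

end

lemma norm_ell2_sq: "(norm x)\<^sup>2 = (\<Sum>i. (coord x i)\<^sup>2)"
  by (simp only: power2_norm_eq_inner inner_ell2_def) (simp add: power2_eq_square)

lemma abs_coord_le_norm: "\<bar>coord x i\<bar> \<le> norm x"
proof (rule power2_le_imp_le)
  have "(\<Sum>j\<in>{i}. (coord x j)\<^sup>2) \<le> (\<Sum>j. (coord x j)\<^sup>2)"
    by (rule sum_le_suminf[OF summable_coord_sq]) auto
  then show "\<bar>coord x i\<bar>\<^sup>2 \<le> (norm x)\<^sup>2"
    by (simp add: norm_ell2_sq)
qed simp

instance ell2 :: complete_space
proof
  fix X :: "nat \<Rightarrow> ell2"
  assume X: "Cauchy X"
  have "convergent (\<lambda>k. coord (X k) i)" for i
  proof (rule Cauchy_convergent, rule metric_CauchyI)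
    fix e :: real assume "0 < e"
    then obtain M where M: "\<And>k l. k \<ge> M \<Longrightarrow> l \<ge> M \<Longrightarrow> dist (X k) (X l) < e"
      using metric_CauchyD[OF X] by blast
    have "dist (coord (X k) i) (coord (X l) i) < e" if "k \<ge> M" "l \<ge> M" for k l
      using abs_coord_le_norm[of "X k - X l" i] M[OF that]
      by (simp add: coord_simps dist_norm)
    then show "\<exists>M. \<forall>k\<ge>M. \<forall>l\<ge>M. dist (coord (X k) i) (coord (X l) i) < e" by blast
  qed
  then obtain y where y: "\<And>i. (\<lambda>k. coord (X k) i) \<longlonglongrightarrow> y i"
    unfolding convergent_def by metis
  have tail: "\<exists>M. \<forall>k\<ge>M. \<forall>I. (\<Sum>i<I. (coord (X k) i - y i)\<^sup>2) \<le> e\<^sup>2" if e: "0 < e" for e :: real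
  proof -
    obtain M where M: "\<And>k l. k \<ge> M \<Longrightarrow> l \<ge> M \<Longrightarrow> dist (X k) (X l) < e"
      using metric_CauchyD[OF X e] by blast
    have "(\<Sum>i<I. (coord (X k) i - y i)\<^sup>2) \<le> e\<^sup>2" if "k \<ge> M" for k I
    proof (rule LIMSEQ_le_const2)
      show "(\<lambda>l. \<Sum>i<I. (coord (X k) i - coord (X l) i)\<^sup>2) \<longlonglongrightarrow> (\<Sum>i<I. (coord (X k) i - y i)\<^sup>2)"
        by (intro tendsto_intros y)
      have "(\<Sum>i<I. (coord (X k) i - coord (X l) i)\<^sup>2) \<le> e\<^sup>2" if "l \<ge> M" for l
      proof -
        have "(\<Sum>i<I. (coord (X k - X l) i)\<^sup>2) \<le> (norm (X k - X l))\<^sup>2"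
          unfolding norm_ell2_sq by (rule sum_le_suminf[OF summable_coord_sq]) auto
        also have "\<dots> \<le> e\<^sup>2"
          using M[OF \<open>k \<ge> M\<close> that] by (intro power_mono) (auto simp: dist_norm)
        finally show ?thesis by (simp add: coord_simps)
      qed
      then show "\<exists>N. \<forall>l\<ge>N. (\<Sum>i<I. (coord (X k) i - coord (X l) i)\<^sup>2) \<le> e\<^sup>2" by blast
    qed
    then show ?thesis by blast
  qed
  have diff: "summable (\<lambda>i. (coord (X k) i - y i)\<^sup>2)"
    if "\<And>I. (\<Sum>i<I. (coord (X k) i - y i)\<^sup>2) \<le> e\<^sup>2" for k and e :: real
    using that by (intro summableI_nonneg_bounded[where x = "e\<^sup>2"]) auto
  obtain M where "\<And>I. (\<Sum>i<I. (coord (X M) i - y i)\<^sup>2) \<le> 1\<^sup>2"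
    using tail[of 1] by auto
  then have "summable (\<lambda>i. (coord (X M) i - y i)\<^sup>2)"
    by (rule diff)
  then have "summable (\<lambda>i. (coord (X M) i + (-1) * (coord (X M) i - y i))\<^sup>2)"
    by (intro summable_sq_add summable_sq_scale summable_coord_sq)
  then have sy: "coord (Abs_ell2 y) = y"
    by (intro coord_Abs) simp
  have "X \<longlonglongrightarrow> Abs_ell2 y"
  proof (rule metric_LIMSEQ_I)
    fix e :: real assume "0 < e"
    then obtain M where M: "\<And>k I. k \<ge> M \<Longrightarrow> (\<Sum>i<I. (coord (X k) i - y i)\<^sup>2) \<le> (e/2)\<^sup>2"
      using tail[of "e/2"] by auto
    have "dist (X k) (Abs_ell2 y) < e" if "k \<ge> M" for k
    proof -
      have "(norm (X k - Abs_ell2 y))\<^sup>2 = (\<Sum>i. (coord (X k) i - y i)\<^sup>2)"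
        by (simp add: norm_ell2_sq coord_simps sy)
      also have "\<dots> \<le> (e/2)\<^sup>2"
        using M[OF that] diff[OF M[OF that]] by (intro suminf_le_const)
      finally have "norm (X k - Abs_ell2 y) \<le> e/2"
        by (rule power2_le_imp_le) (use \<open>0 < e\<close> in simp)
      then show ?thesis using \<open>0 < e\<close> by (simp add: dist_norm)
    qed
    then show "\<exists>N. \<forall>k\<ge>N. dist (X k) (Abs_ell2 y) < e" by blast
  qed
  then show "convergent X" by (auto simp: convergent_def)
qed

definition smooth :: "real \<Rightarrow> ('a::real_inner \<Rightarrow> real) \<Rightarrow> bool" where
  "smooth l g \<longleftrightarrow> (\<exists>D. (\<forall>u. GDERIV g u :> D u) \<and> l-lipschitz_on UNIV D)"

definition strongly_convex :: "real \<Rightarrow> ('a::real_inner \<Rightarrow> real) \<Rightarrow> bool" where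
  "strongly_convex \<mu> g \<longleftrightarrow> (\<exists>D. (\<forall>u. GDERIV g u :> D u) \<and>
     (\<forall>u v. g v \<ge> g u + inner (D u) (v - u) + \<mu> / 2 * (norm (v - u))\<^sup>2))"

definition convex_conjugate :: "('a::real_inner \<Rightarrow> real) \<Rightarrow> 'a \<Rightarrow> ereal" where
  "convex_conjugate g y = (SUP x. ereal (inner y x - g x))"

text \<open>
  The conjugate of a smooth convex function may take the value \<open>\<infinity>\<close> and need not be
  differentiable everywhere, so its gradient is a partial function: it exists at \<open>y\<close> only if
  the conjugate is finite near \<open>y\<close> and differentiable at \<open>y\<close>.
\<close>
definition conjugate_gradient :: "('a::real_inner \<Rightarrow> real) \<Rightarrow> 'a \<Rightarrow> 'a \<Rightarrow> bool" where
  "conjugate_gradient g y d \<longleftrightarrow>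
     y \<in> interior {z. \<bar>convex_conjugate g z\<bar> \<noteq> \<infinity>} \<and>
     GDERIV (\<lambda>z. real_of_ereal (convex_conjugate g z)) y :> d"

text \<open>
  Nodes are \<open>0, \<dots>, m - 1\<close>. Only the entries \<open>W i j\<close> with \<open>i, j < m\<close> and the components \<open>x i\<close>
  with \<open>i < m\<close> are meaningful.
\<close>

definition network :: "nat \<Rightarrow> (nat \<Rightarrow> (nat \<times> nat) set) \<Rightarrow> bool" where
  "network m G \<longleftrightarrow> (\<forall>q. G q \<subseteq> {..<m} \<times> {..<m} \<and> sym (G q) \<and> irrefl (G q))"

definition mat_apply :: "nat \<Rightarrow> (nat \<Rightarrow> nat \<Rightarrow> real) \<Rightarrow> (nat \<Rightarrow> 'a::real_vector) \<Rightarrow> nat \<Rightarrow> 'a" where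
  "mat_apply m W x i = (\<Sum>j<m. W i j *\<^sub>R x j)"

text \<open>
  For \<open>x\<close> with components in \<open>ell2\<close>, \<^term>\<open>mat_apply m W x\<close> is the action of the Kronecker
  product of \<open>W\<close> with the identity; for real components it is the plain matrix-vector product.
\<close>
definition gossip :: "real \<Rightarrow> nat \<Rightarrow> (nat \<times> nat) set \<Rightarrow> (nat \<Rightarrow> nat \<Rightarrow> real) \<Rightarrow> bool" where
  "gossip chi m E W \<longleftrightarrow>
     (\<forall>i<m. \<forall>j<m. W i j \<noteq> 0 \<longleftrightarrow> (i, j) \<in> E \<or> i = j) \<and>
     (\<forall>c::real. \<forall>i<m. mat_apply m W (\<lambda>_. c) i = 0) \<and>
     (\<forall>a::nat \<Rightarrow> real. (\<Sum>i<m. mat_apply m W a i) = 0) \<and>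
     (\<forall>x::nat \<Rightarrow> ell2. (\<Sum>i<m. x i) = 0 \<longrightarrow>
        (\<Sum>i<m. (norm (mat_apply m W x i - x i))\<^sup>2) \<le> (1 - 1 / chi) * (\<Sum>i<m. (norm (x i))\<^sup>2))"

definition local_objective :: "nat \<Rightarrow> (nat \<Rightarrow> nat \<Rightarrow> 'a \<Rightarrow> real) \<Rightarrow> nat \<Rightarrow> 'a \<Rightarrow> real" where
  "local_objective n f i x = (1 / real n) * (\<Sum>j<n. f i j x)"

definition decentralized_problem ::
  "nat \<Rightarrow> real \<Rightarrow> real \<Rightarrow> real \<Rightarrow> nat \<Rightarrow> (nat \<Rightarrow> (nat \<times> nat) set) \<Rightarrow> (nat \<Rightarrow> nat \<Rightarrow> nat \<Rightarrow> real)
   \<Rightarrow> (nat \<Rightarrow> nat \<Rightarrow> ell2 \<Rightarrow> real) \<Rightarrow> bool" where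
  "decentralized_problem n chi \<kappa>b \<kappa>s m G W f \<longleftrightarrow>
     1 \<le> m \<and> network m G \<and> (\<forall>q. gossip chi m (G q) (W q)) \<and>
     (\<exists>(Lf :: nat \<Rightarrow> nat \<Rightarrow> real) (L :: nat \<Rightarrow> real) (\<mu> :: nat \<Rightarrow> real).
        (\<forall>i<m. \<forall>j<n. convex_on UNIV (f i j) \<and> smooth (Lf i j) (f i j)) \<and>
        (\<forall>i<m. 0 < \<mu> i \<and> strongly_convex (\<mu> i) (local_objective n f i) \<and>
               smooth (L i) (local_objective n f i)) \<and>
        (\<forall>i<m. L i / \<mu> i \<le> \<kappa>b \<and> (1 / real n) * (\<Sum>j<n. Lf i j / \<mu> i) \<le> \<kappa>s))"

definition minimizer :: "('a \<Rightarrow> real) \<Rightarrow> 'a \<Rightarrow> bool" where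
  "minimizer g x \<longleftrightarrow> (\<forall>y. g x \<le> g y)"

definition eps_solution :: "real \<Rightarrow> 'a::real_normed_vector \<Rightarrow> 'a \<Rightarrow> bool" where
  "eps_solution \<epsilon> xstar x \<longleftrightarrow> (norm (x - xstar))\<^sup>2 \<le> \<epsilon> * (norm (0 - xstar))\<^sup>2"

datatype 'a oracle_call = Grad (index: nat) (point: 'a) | Conj_Grad (index: nat) (point: 'a)

fun oracle_answer :: "(nat \<Rightarrow> 'a::real_inner \<Rightarrow> real) \<Rightarrow> 'a oracle_call \<Rightarrow> 'a \<Rightarrow> bool" where
  "oracle_answer f (Grad j x) d \<longleftrightarrow> GDERIV (f j) x :> d"
| "oracle_answer f (Conj_Grad j x) d \<longleftrightarrow> conjugate_gradient (f j) x d"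

definition comm_count :: "(nat \<Rightarrow> bool) \<Rightarrow> nat \<Rightarrow> nat" where
  "comm_count comm k = card {l. l < k \<and> comm l}"

text \<open>
  An algorithm is represented by its execution on the problem: \<open>comm k\<close> says whether step \<open>k\<close> is
  communicational (otherwise it is computational), \<open>H i k\<close> is the memory of node \<open>i\<close> at step \<open>k\<close>,
  \<open>out i k\<close> its output, and \<open>Q i k\<close> the set of oracle calls that node \<open>i\<close> makes during the
  computational step \<open>k\<close>. The sets \<open>Q i k\<close> may be infinite; if \<open>Q i k\<close> consists of all calls with
  index below \<open>n\<close> at points of \<open>H i k\<close>, the memory constraint of a computational step is
  inclusion in the span of all \<open>x\<close> and all gradients of the \<open>f i j\<close> and of their conjugates at
  \<open>x\<close>, where \<open>x\<close> ranges over \<open>H i k\<close>. The graphs are consumed one per communicational step, so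
  the graph in use at step \<open>k\<close> is number \<^term>\<open>comm_count comm k\<close> of the sequence.
\<close>
definition first_order_run ::
  "nat \<Rightarrow> nat \<Rightarrow> (nat \<Rightarrow> (nat \<times> nat) set) \<Rightarrow> (nat \<Rightarrow> nat \<Rightarrow> 'a::real_inner \<Rightarrow> real) \<Rightarrow> (nat \<Rightarrow> bool)
   \<Rightarrow> (nat \<Rightarrow> nat \<Rightarrow> 'a set) \<Rightarrow> (nat \<Rightarrow> nat \<Rightarrow> 'a oracle_call set) \<Rightarrow> (nat \<Rightarrow> nat \<Rightarrow> 'a) \<Rightarrow> bool" where
  "first_order_run n m G f comm H Q out \<longleftrightarrow>
     (\<forall>i<m. H i 0 = {0}) \<and>
     (\<forall>i<m. \<forall>k. out i k \<in> H i k) \<and>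
     (\<forall>i<m. \<forall>k. \<not> comm k \<longrightarrow>
        (\<forall>c\<in>Q i k. index c < n \<and> point c \<in> H i k) \<and>
        H i (Suc k) \<subseteq> span (H i k \<union> {d. \<exists>c\<in>Q i k. oracle_answer (f i) c d})) \<and>
     (\<forall>i<m. \<forall>k. comm k \<longrightarrow>
        H i (Suc k) \<subseteq> span ((\<Union>j\<in>{j. (i, j) \<in> G (comm_count comm k)}. H j k) \<union> H i k))"

text \<open>
  The calls that node \<open>i\<close> has made before step \<open>K\<close>, tagged with the step, so that repeated
  evaluations count repeatedly.
\<close>
definition oracle_calls ::
  "(nat \<Rightarrow> bool) \<Rightarrow> (nat \<Rightarrow> nat \<Rightarrow> 'a oracle_call set) \<Rightarrow> nat \<Rightarrow> nat \<Rightarrow> (nat \<times> 'a oracle_call) set" where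
  "oracle_calls comm Q i K = {(k, c). k < K \<and> \<not> comm k \<and> c \<in> Q i k}"

end

theory Submission
  imports Defs
begin

text \<open>
  The space is split into \<open>n\<close> blocks, each a copy of the square-summable sequences, and on every
  block the sum of the objectives is a Nesterov path: a weight \<open>a\<close> times the path Laplacian, plus
  a multiple of \<open>\<parallel>x\<parallel>\<^sup>2\<close>, minus a linear term at position \<open>0\<close>. Its minimizer decays geometrically,
  \<open>q ^ k\<close> at position \<open>k\<close>, with \<open>1 - q\<close> of order \<open>1 / sqrt \<kappa>b\<close>. A point that vanishes from position
  \<open>d j\<close> on in block \<open>j\<close> misses at least the average of the \<open>q ^ (2 * d j)\<close>, so an
  \<open>\<epsilon>\<close>-solution needs levels \<open>d j\<close> of order \<open>sqrt \<kappa>b * ln (1 / \<epsilon>)\<close> on average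
  (\<open>eps_solution_levels\<close>).

  The path edges are dealt out alternately to two end nodes. A set of edges without common
  endpoints is the quadratic form of \<open>I - S\<close> for a permutation \<open>S\<close> of order two of the
  coordinates. The gradient of such a quadratic is \<open>\<mu> I + w (I - S)\<close> up to a constant, and its
  inverse, which is the gradient of the conjugate, is again a combination of \<open>I\<close> and \<open>S\<close>, up to
  a constant. So either oracle of an end node extends an initial segment of a block by at most one
  position, and then the other end node has to act (\<open>oracle_answer_below_levels\<close>).

  Function number \<open>j\<close> of an end node carries block \<open>j\<close> alone, with a factor \<open>n\<close>. This allows
  \<open>\<kappa>s = n * \<kappa>b\<close>, for which \<open>n + sqrt (n * \<kappa>s)\<close> is of order \<open>n * sqrt \<kappa>b\<close>; and since the levels of
  block \<open>j\<close> grow only through calls with index \<open>j\<close>, that is also the number of calls needed at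
  node \<open>0\<close> (\<open>oracle_call_lower_bound\<close>).

  Between the end nodes lie about \<open>chi\<close> relays, and the network is a star whose centre runs
  through the relays cyclically. A new position known to one end node reaches, in each round, only
  the current centre, which forwards what it knew before; it reaches the other end node only when
  some relay is the centre for the second time. So each further position costs a full period, of
  order \<open>chi\<close> rounds (\<open>communication_lower_bound\<close>), while the star still has gossip constant at
  most \<open>chi\<close>. With one node at either end rather than a fixed fraction of them, the calls
  cannot be shared out among several nodes; and the conditioning of the sum does not suffer from
  the many relays because the convexity constants of the relays are taken small.
\<close>

section \<open>Convex functions and their conjugates\<close>

lemma GDERIV_unique:
  assumes "GDERIV g x :> d" "GDERIV g x :> e"
  shows "d = e"
proof -
  have "(\<lambda>h. inner h d) = (\<lambda>h. inner h e)"
    using assms unfolding gderiv_def by (rule has_derivative_unique)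
  then have "inner (d - e) (d - e) = 0"
    by (metis inner_diff_right right_minus_eq)
  then show ?thesis by simp
qed

lemma convex_on_of_first_order:
  fixes g :: "'a::real_inner \<Rightarrow> real"
  assumes first_order: "\<And>u v. g v \<ge> g u + inner (D u) (v - u)"
  shows "convex_on UNIV g"
proof (rule convex_onI)
  fix t :: real and x y :: 'a
  assume t: "0 < t" "t < 1"
  let ?z = "(1 - t) *\<^sub>R x + t *\<^sub>R y"
  have "(1 - t) * (g ?z + inner (D ?z) (x - ?z)) + t * (g ?z + inner (D ?z) (y - ?z))
      \<le> (1 - t) * g x + t * g y"
    using t first_order by (intro add_mono mult_left_mono) auto
  moreover have "(1 - t) * inner (D ?z) (x - ?z) + t * inner (D ?z) (y - ?z)
      = inner (D ?z) ((1 - t) *\<^sub>R (x - ?z) + t *\<^sub>R (y - ?z))"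
    by (simp add: inner_add_right)
  moreover have "(1 - t) *\<^sub>R (x - ?z) + t *\<^sub>R (y - ?z) = 0"
    by (simp add: algebra_simps)
  ultimately show "g ?z \<le> (1 - t) * g x + t * g y"
    by (simp add: algebra_simps)
qed simp

text \<open>
  If \<open>y\<close> is a subgradient of \<open>g\<close> at \<open>x\<close>, the supremum defining the conjugate at \<open>y\<close> is attained
  at \<open>x\<close>. The conjugate then lies above the affine function \<open>z \<mapsto> \<langle>z, x\<rangle> - g x\<close> and touches it
  at \<open>y\<close>, so \<open>x\<close> is the only gradient it can have there.
\<close>
lemma conjugate_gradient_eq_subgradient_point:
  assumes grad: "conjugate_gradient g y d"
    and subgrad: "\<And>u. g u \<ge> g x + inner y (u - x)"
  shows "d = x"
proof -
  let ?c = "\<lambda>z. real_of_ereal (convex_conjugate g z)"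
  let ?U = "interior {z. \<bar>convex_conjugate g z\<bar> \<noteq> \<infinity>}"
  have lower: "ereal (inner z x - g x) \<le> convex_conjugate g z" for z
    unfolding convex_conjugate_def by (rule SUP_upper) simp
  have "convex_conjugate g y \<le> ereal (inner y x - g x)"
    unfolding convex_conjugate_def
    by (rule SUP_least) (use subgrad in \<open>simp add: inner_diff_right algebra_simps\<close>)
  then have touch: "?c y = inner y x - g x"
    using lower[of y] by (metis antisym real_of_ereal.simps(1))
  have above: "inner z x - g x \<le> ?c z" if "z \<in> ?U" for z
  proof -
    have "\<bar>convex_conjugate g z\<bar> \<noteq> \<infinity>" using subsetD[OF interior_subset that] by simp
    then show ?thesis using lower[of z] by (cases "convex_conjugate g z") auto
  qed
  have y: "y \<in> ?U" and der: "(?c has_derivative (\<lambda>h. inner h d)) (at y)"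
    using grad unfolding conjugate_gradient_def gderiv_def by auto
  have "((\<lambda>z. ?c z - inner z x) has_derivative (\<lambda>h. inner h d - inner h x)) (at y)"
    by (intro has_derivative_diff der has_derivative_inner_left has_derivative_ident)
  moreover have "eventually (\<lambda>z. ?c y - inner y x \<le> ?c z - inner z x) (at y)"
    using eventually_at_in_open'[OF open_interior y]
    by (rule eventually_mono) (use above touch in fastforce)
  ultimately have "(\<lambda>h. inner h d - inner h x) = (\<lambda>h. 0)"
    by (rule has_derivative_local_min)
  then have "inner (d - x) (d - x) = 0"
    by (metis inner_diff_right)
  then show ?thesis by simp
qed

section \<open>Quadratics built from a reflection\<close>

locale reflection =
  fixes S :: "'a::real_inner \<Rightarrow> 'a"
  assumes linear_S: "linear S"
    and self_adjoint: "inner (S x) y = inner x (S y)"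
    and involutive: "S (S x) = x"
begin

lemma norm_S: "norm (S x) = norm x"
  by (simp add: norm_eq_sqrt_inner self_adjoint involutive)

lemma bounded_linear_S: "bounded_linear S"
  using linear_S by (intro bounded_linear_intro[of S 1]) (auto simp: linear_add linear_scale norm_S)

lemma inner_minus_S_nonneg: "0 \<le> inner x (x - S x)"
  using norm_cauchy_schwarz[of x "S x"]
  by (simp add: inner_diff_right norm_S power2_norm_eq_inner flip: power2_eq_square)

end

text \<open>
  When \<open>S\<close> exchanges the two ends of each of a family of disjoint edges, \<open>inner x (x - S x)\<close> is
  the sum of the squared differences along these edges.
\<close>
definition reflected_quadratic :: "('a::real_inner \<Rightarrow> 'a) \<Rightarrow> real \<Rightarrow> real \<Rightarrow> 'a \<Rightarrow> 'a \<Rightarrow> real" where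
  "reflected_quadratic S \<mu> w b x = \<mu> / 2 * (norm x)\<^sup>2 + w / 2 * inner x (x - S x) - inner b x"

definition reflected_gradient :: "('a::real_inner \<Rightarrow> 'a) \<Rightarrow> real \<Rightarrow> real \<Rightarrow> 'a \<Rightarrow> 'a \<Rightarrow> 'a" where
  "reflected_gradient S \<mu> w b x = \<mu> *\<^sub>R x + w *\<^sub>R (x - S x) - b"

context reflection
begin

lemma reflected_quadratic_expand:
  "reflected_quadratic S \<mu> w b v = reflected_quadratic S \<mu> w b u
     + inner (reflected_gradient S \<mu> w b u) (v - u)
     + \<mu> / 2 * (norm (v - u))\<^sup>2 + w / 2 * inner (v - u) ((v - u) - S (v - u))"
proof -
  define d where "d = v - u"
  have v: "v = u + d" by (simp add: d_def)
  have sym: "inner d (S u) = inner u (S d)" "inner (S u) d = inner u (S d)" "inner d u = inner u d"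
    by (metis inner_commute self_adjoint)+
  have "reflected_quadratic S \<mu> w b v = \<mu> / 2 * (inner u u + 2 * inner u d + inner d d)
      + w / 2 * (inner u u + 2 * inner u d + inner d d
          - (inner u (S u) + 2 * inner u (S d) + inner d (S d)))
      - (inner b u + inner b d)"
    unfolding v reflected_quadratic_def power2_norm_eq_inner
    by (simp add: linear_add[OF linear_S] inner_add_left inner_add_right inner_diff_right sym algebra_simps)
  moreover have "reflected_quadratic S \<mu> w b u
      = \<mu> / 2 * inner u u + w / 2 * (inner u u - inner u (S u)) - inner b u"
    unfolding reflected_quadratic_def power2_norm_eq_inner by (simp add: inner_diff_right)
  moreover have "inner (reflected_gradient S \<mu> w b u) d
      = \<mu> * inner u d + w * (inner u d - inner u (S d)) - inner b d"
    unfolding reflected_gradient_def by (simp add: inner_diff_left inner_add_left sym)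
  ultimately show ?thesis
    unfolding d_def[symmetric] power2_norm_eq_inner by (simp add: inner_diff_right field_simps)
qed

lemma reflected_quadratic_GDERIV:
  "GDERIV (reflected_quadratic S \<mu> w b) x :> reflected_gradient S \<mu> w b x"
proof -
  have "((\<lambda>x. \<mu> / 2 * inner x x + w / 2 * inner x (x - S x) - inner b x) has_derivative
      (\<lambda>h. \<mu> / 2 * (inner x h + inner h x) + w / 2 * (inner x (h - S h) + inner h (x - S x)) - inner b h)) (at x)"
    by (intro has_derivative_diff has_derivative_add has_derivative_mult_right has_derivative_inner
        has_derivative_ident has_derivative_inner_right
        bounded_linear.has_derivative[OF bounded_linear_S])
  moreover have "\<mu> / 2 * (inner x h + inner h x) + w / 2 * (inner x (h - S h) + inner h (x - S x)) - inner b h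
      = inner h (reflected_gradient S \<mu> w b x)" for h
  proof -
    have "inner x (S h) = inner h (S x)" "inner x h = inner h x" "inner b h = inner h b"
      by (metis inner_commute self_adjoint)+
    then show ?thesis
      unfolding reflected_gradient_def by (simp add: inner_diff_right inner_add_right field_simps)
  qed
  ultimately show ?thesis
    unfolding gderiv_def reflected_quadratic_def[abs_def] power2_norm_eq_inner by simp
qed

lemma reflected_quadratic_strong_lower_bound:
  assumes "0 \<le> w"
  shows "reflected_quadratic S \<mu> w b v \<ge> reflected_quadratic S \<mu> w b u
     + inner (reflected_gradient S \<mu> w b u) (v - u) + \<mu> / 2 * (norm (v - u))\<^sup>2"
  using reflected_quadratic_expand[of \<mu> w b v u] inner_minus_S_nonneg[of "v - u"] assms by simp

lemma reflected_quadratic_first_order: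
  assumes "0 \<le> \<mu>" "0 \<le> w"
  shows "reflected_quadratic S \<mu> w b v \<ge> reflected_quadratic S \<mu> w b u
     + inner (reflected_gradient S \<mu> w b u) (v - u)"
proof -
  have "0 \<le> \<mu> / 2 * (norm (v - u))\<^sup>2" using assms by simp
  then show ?thesis using reflected_quadratic_strong_lower_bound[OF assms(2), of \<mu> b u v] by linarith
qed

lemma reflected_quadratic_convex:
  "0 \<le> \<mu> \<Longrightarrow> 0 \<le> w \<Longrightarrow> convex_on UNIV (reflected_quadratic S \<mu> w b)"
  by (rule convex_on_of_first_order[OF reflected_quadratic_first_order])

lemma reflected_quadratic_strongly_convex:
  "0 \<le> w \<Longrightarrow> strongly_convex \<mu> (reflected_quadratic S \<mu> w b)"
  unfolding strongly_convex_def
  using reflected_quadratic_GDERIV reflected_quadratic_strong_lower_bound by blast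

text \<open>The factor \<open>2\<close> is the norm of \<open>I - S\<close> when \<open>S\<close> has the eigenvalue \<open>-1\<close>.\<close>
lemma reflected_quadratic_smooth:
  assumes "0 \<le> \<mu>" "0 \<le> w"
  shows "smooth (\<mu> + 2 * w) (reflected_quadratic S \<mu> w b)"
  unfolding smooth_def
proof (intro exI conjI allI lipschitz_onI)
  show "GDERIV (reflected_quadratic S \<mu> w b) u :> reflected_gradient S \<mu> w b u" for u
    by (rule reflected_quadratic_GDERIV)
  show "dist (reflected_gradient S \<mu> w b x) (reflected_gradient S \<mu> w b y) \<le> (\<mu> + 2 * w) * dist x y" for x y
  proof -
    let ?d = "x - y"
    have "reflected_gradient S \<mu> w b x - reflected_gradient S \<mu> w b y = \<mu> *\<^sub>R ?d + w *\<^sub>R (?d - S ?d)"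
      by (simp add: reflected_gradient_def linear_diff[OF linear_S] algebra_simps)
    moreover have "norm (\<mu> *\<^sub>R ?d + w *\<^sub>R (?d - S ?d)) \<le> \<mu> * norm ?d + w * (norm ?d + norm (S ?d))"
      using assms
      by (intro order_trans[OF norm_triangle_ineq] add_mono)
        (auto intro!: mult_left_mono norm_triangle_ineq4)
    moreover have "\<mu> * norm ?d + w * (norm ?d + norm (S ?d)) = (\<mu> + 2 * w) * norm ?d"
      unfolding norm_S by (simp add: algebra_simps)
    ultimately show ?thesis
      unfolding dist_norm by simp
  qed
qed (use assms in simp)

text \<open>
  The gradient map is inverted explicitly: as \<open>S\<close> is an involution, the inverse of
  \<open>(\<mu> + w) I - w S\<close> is again a combination of \<open>I\<close> and \<open>S\<close>. Hence both oracles answer inside the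
  span of the query, \<open>b\<close> and their images under \<open>S\<close>.
\<close>
lemma reflected_quadratic_conjugate_gradient:
  assumes "conjugate_gradient (reflected_quadratic S \<mu> w b) y d" "0 < \<mu>" "0 \<le> w"
  shows "d = (1 / (\<mu> * (\<mu> + 2 * w))) *\<^sub>R ((\<mu> + w) *\<^sub>R (y + b) + w *\<^sub>R S (y + b))"
    (is "d = ?x")
proof (rule conjugate_gradient_eq_subgradient_point[OF assms(1)])
  define z where "z = y + b"
  define c where "c = 1 / (\<mu> * (\<mu> + 2 * w))"
  have c: "c * (\<mu> * (\<mu> + 2 * w)) = 1" using assms by (simp add: c_def)
  have x: "?x = (c * (\<mu> + w)) *\<^sub>R z + (c * w) *\<^sub>R S z"
    by (simp add: c_def z_def scaleR_add_right)
  have "S ?x = (c * (\<mu> + w)) *\<^sub>R S z + (c * w) *\<^sub>R z"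
    unfolding x by (simp add: linear_add[OF linear_S] linear_scale[OF linear_S] involutive)
  then have "\<mu> *\<^sub>R ?x + w *\<^sub>R (?x - S ?x)
      = (\<mu> * (c * (\<mu> + w)) + w * (c * (\<mu> + w) - c * w)) *\<^sub>R z
        + (\<mu> * (c * w) + w * (c * w - c * (\<mu> + w))) *\<^sub>R S z"
    unfolding x by (simp only: scaleR_add_left scaleR_diff_left scaleR_add_right scaleR_diff_right
        scaleR_scaleR) (simp add: algebra_simps)
  also have "\<mu> * (c * (\<mu> + w)) + w * (c * (\<mu> + w) - c * w) = c * (\<mu> * (\<mu> + 2 * w))"
    by (simp add: algebra_simps)
  also have "\<mu> * (c * w) + w * (c * w - c * (\<mu> + w)) = 0" by (simp add: algebra_simps)
  finally have "\<mu> *\<^sub>R ?x + w *\<^sub>R (?x - S ?x) = z" using c by simp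
  then have "reflected_gradient S \<mu> w b ?x = y"
    by (simp add: reflected_gradient_def z_def)
  then show "reflected_quadratic S \<mu> w b u \<ge> reflected_quadratic S \<mu> w b ?x + inner y (u - ?x)" for u
    using reflected_quadratic_first_order[of \<mu> w b ?x u] assms by simp
qed

text \<open>
  Either answer to a query \<open>x\<close> is a linear combination of \<open>x\<close>, \<open>S x\<close>, \<open>b\<close> and, for the conjugate,
  \<open>S b\<close>. With \<open>S b = b\<close> the last of these opens no further direction, so both oracles are equally
  confined.
\<close>
lemma reflected_quadratic_oracle_answer:
  assumes answer: "oracle_answer f c d" and f: "f (index c) = reflected_quadratic S \<mu> w b"
    and V: "subspace V" "U \<subseteq> V" "S ` U \<subseteq> V" "b \<in> V" "S b = b"
    and c: "point c \<in> U" and pos: "0 < \<mu>" "0 \<le> w"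
  shows "d \<in> V"
proof (cases c)
  case (Grad j x)
  then have "d = reflected_gradient S \<mu> w b x"
    using answer f GDERIV_unique[OF _ reflected_quadratic_GDERIV] by force
  then show ?thesis
    using V c Grad unfolding reflected_gradient_def
    by (auto intro!: subspace_diff subspace_add subspace_scale)
next
  case (Conj_Grad j x)
  then have "conjugate_gradient (reflected_quadratic S \<mu> w b) x d"
    using answer f by simp
  from reflected_quadratic_conjugate_gradient[OF this pos]
  have "d = (1 / (\<mu> * (\<mu> + 2 * w))) *\<^sub>R ((\<mu> + w) *\<^sub>R (x + b) + w *\<^sub>R (S x + b))"
    by (simp only: linear_add[OF linear_S] V(5))
  then show ?thesis
    using V c Conj_Grad by (auto intro!: subspace_diff subspace_add subspace_scale)
qed

end

text \<open>
  For fixed \<open>\<mu>\<close> the quadratic is affine in \<open>w * (I - S)\<close> and \<open>b\<close>. When the matrices \<open>I - S j\<close> act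
  on different blocks, their sum \<open>I - T\<close> is again of this form, and the average is smoother than
  its terms by a factor up to \<open>n\<close>.
\<close>
lemma average_reflected_quadratics:
  assumes n: "0 < n"
    and S: "\<And>x. x - T x = (\<Sum>j<n. x - S j x)"
    and b: "b = (1 / real n) *\<^sub>R (\<Sum>j<n. c j)"
  shows "(1 / real n) * (\<Sum>j<n. reflected_quadratic (S j) \<mu> (real n * w) (c j) x)
    = reflected_quadratic T \<mu> w b x"
proof -
  have "(\<Sum>j<n. reflected_quadratic (S j) \<mu> (real n * w) (c j) x)
     = real n * (\<mu> / 2 * (norm x)\<^sup>2) + real n * w / 2 * inner x (\<Sum>j<n. x - S j x)
        - inner (\<Sum>j<n. c j) x"
    unfolding reflected_quadratic_def sum.distrib sum_subtractf[of _ "\<lambda>j. inner (c j) x"] inner_sum_right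
    by (simp only: inner_sum_left sum_distrib_left) simp
  then show ?thesis
    unfolding S[symmetric] b reflected_quadratic_def using n by (simp add: field_simps)
qed

section \<open>Coordinate permutations and supports\<close>

definition permute :: "(nat \<Rightarrow> nat) \<Rightarrow> ell2 \<Rightarrow> ell2" where
  "permute \<sigma> x = Abs_ell2 (\<lambda>p. coord x (\<sigma> p))"

lemma sums_bij_reindex:
  fixes g :: "nat \<Rightarrow> real"
  assumes "bij \<sigma>" "summable (\<lambda>p. \<bar>g p\<bar>)"
  shows "(\<lambda>p. g (\<sigma> p)) sums suminf g"
proof -
  have "g sums suminf g"
    by (rule summable_sums[OF summable_rabs_cancel[OF assms(2)]])
  then have "(g has_sum suminf g) UNIV"
    by (rule norm_summable_imp_has_sum[rotated]) (simp add: assms(2))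
  then have "((\<lambda>p. g (\<sigma> p)) has_sum suminf g) UNIV"
    by (rule iffD2[OF has_sum_reindex_bij_betw[OF assms(1)]])
  then show ?thesis by (rule has_sum_imp_sums)
qed

lemma coord_permute:
  assumes "bij \<sigma>"
  shows "coord (permute \<sigma> x) p = coord x (\<sigma> p)"
proof -
  have "summable (\<lambda>p. (coord x (\<sigma> p))\<^sup>2)"
    using sums_bij_reindex[OF assms, of "\<lambda>p. (coord x p)\<^sup>2"] summable_coord_sq[of x]
    by (simp add: sums_iff)
  then show ?thesis by (simp add: permute_def coord_Abs)
qed

lemma reflection_permute:
  assumes inv: "\<And>p. \<sigma> (\<sigma> p) = p"
  shows "reflection (permute \<sigma>)"
proof (rule reflection.intro)
  have bij: "bij \<sigma>" by (rule involuntory_imp_bij) (rule inv)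
  note coord = coord_permute[OF bij]
  show "linear (permute \<sigma>)"
  proof (rule linearI)
    show "permute \<sigma> (x + y) = permute \<sigma> x + permute \<sigma> y" for x y
      by (rule ell2_eqI) (simp add: coord_simps coord)
    show "permute \<sigma> (r *\<^sub>R x) = r *\<^sub>R permute \<sigma> x" for r x
      by (rule ell2_eqI) (simp add: coord_simps coord)
  qed
  show "permute \<sigma> (permute \<sigma> x) = x" for x
    by (rule ell2_eqI) (simp add: inv coord)
  show "inner (permute \<sigma> x) y = inner x (permute \<sigma> y)" for x y
  proof -
    have "summable (\<lambda>p. \<bar>coord x p\<bar> * \<bar>coord (permute \<sigma> y) p\<bar>)"
      using summable_coord_sq by (intro summable_mult_of_sq) simp_all
    then have "(\<lambda>p. coord x (\<sigma> p) * coord (permute \<sigma> y) (\<sigma> p)) sums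
        (\<Sum>p. coord x p * coord (permute \<sigma> y) p)"
      by (intro sums_bij_reindex[OF bij]) (simp add: abs_mult)
    then have "(\<Sum>p. coord x (\<sigma> p) * coord y p) = (\<Sum>p. coord x p * coord y (\<sigma> p))"
      unfolding coord inv by (rule sums_unique[symmetric])
    then show ?thesis
      by (simp only: inner_ell2_def coord)
  qed
qed

definition unit_vector :: "nat \<Rightarrow> ell2" where
  "unit_vector j = Abs_ell2 (\<lambda>p. if p = j then 1 else 0)"

lemma coord_unit_vector: "coord (unit_vector j) p = (if p = j then 1 else 0)"
proof -
  have "summable (\<lambda>p. (if p = j then 1 else 0 :: real)\<^sup>2)"
    by (rule summable_finite[of "{j}"]) auto
  then show ?thesis by (simp add: unit_vector_def coord_Abs)
qed

lemma coord_sum: "coord (\<Sum>j\<in>A. x j) p = (\<Sum>j\<in>A. coord (x j) p)"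
  by (induction A rule: infinite_finite_induct) (simp_all add: coord_simps)

definition supported_in :: "nat set \<Rightarrow> ell2 set" where
  "supported_in A = {x. \<forall>p. p \<notin> A \<longrightarrow> coord x p = 0}"

lemma subspace_supported_in: "subspace (supported_in A)"
  by (auto simp: subspace_def supported_in_def coord_simps)

lemma supported_in_mono: "A \<subseteq> B \<Longrightarrow> supported_in A \<subseteq> supported_in B"
  by (auto simp: supported_in_def)

lemma permute_supported_in:
  assumes "\<And>p. \<sigma> (\<sigma> p) = p" "\<sigma> ` A \<subseteq> B"
  shows "permute \<sigma> ` supported_in A \<subseteq> supported_in B"
proof -
  have bij: "bij \<sigma>" by (rule involuntory_imp_bij) (rule assms(1))
  have "\<sigma> p \<notin> A" if "p \<notin> B" for p
  proof
    assume "\<sigma> p \<in> A"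
    then have "\<sigma> (\<sigma> p) \<in> B" using assms(2) by blast
    then show False using that by (simp only: assms(1))
  qed
  then show ?thesis
    by (auto simp: supported_in_def coord_permute[OF bij])
qed

section \<open>Blocks of coordinates\<close>

text \<open>
  A coordinate \<open>p\<close> stands for position \<open>p div n\<close> in block \<open>p mod n\<close>: the space is a sum of \<open>n\<close>
  copies of the square-summable sequences.
\<close>

definition map_positions :: "nat \<Rightarrow> nat set \<Rightarrow> (nat \<Rightarrow> nat) \<Rightarrow> nat \<Rightarrow> nat" where
  "map_positions n J \<tau> p = (if p mod n \<in> J then \<tau> (p div n) * n + p mod n else p)"

lemma map_positions_involution:
  assumes "0 < n" "\<And>k. \<tau> (\<tau> k) = k"
  shows "map_positions n J \<tau> (map_positions n J \<tau> p) = p"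
  using assms by (simp add: map_positions_def)

lemma map_positions_mod: "0 < n \<Longrightarrow> map_positions n J \<tau> p mod n = p mod n"
  by (simp add: map_positions_def)

lemma map_positions_div:
  "0 < n \<Longrightarrow> map_positions n J \<tau> p div n = (if p mod n \<in> J then \<tau> (p div n) else p div n)"
  by (simp add: map_positions_def)

definition below_levels :: "nat \<Rightarrow> (nat \<Rightarrow> nat) \<Rightarrow> ell2 set" where
  "below_levels n d = supported_in {p. p div n < d (p mod n)}"

lemma subspace_below_levels: "subspace (below_levels n d)"
  by (simp add: below_levels_def subspace_supported_in)

lemma below_levels_mono: "(\<And>j. d j \<le> e j) \<Longrightarrow> below_levels n d \<subseteq> below_levels n e"
  unfolding below_levels_def by (rule supported_in_mono) (auto intro: less_le_trans)

lemma permute_below_levels: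
  assumes "0 < n" "\<And>k. \<tau> (\<tau> k) = k"
    and "\<And>j k. j \<in> J \<Longrightarrow> k < d j \<Longrightarrow> \<tau> k < e j" and "\<And>j. d j \<le> e j"
  shows "permute (map_positions n J \<tau>) ` below_levels n d \<subseteq> below_levels n e"
  unfolding below_levels_def
proof (rule permute_supported_in)
  show "map_positions n J \<tau> (map_positions n J \<tau> p) = p" for p
    by (rule map_positions_involution) fact+
  show "map_positions n J \<tau> ` {p. p div n < d (p mod n)} \<subseteq> {p. p div n < e (p mod n)}"
    using assms(1,3,4)
    by (auto simp: map_positions_mod map_positions_div) (metis order_less_le_trans)
qed

lemma minus_permute_eq_sum_blocks:
  assumes "0 < n" "\<And>k. \<tau> (\<tau> k) = k"
  shows "x - permute (map_positions n UNIV \<tau>) x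
    = (\<Sum>j<n. x - permute (map_positions n {j} \<tau>) x)"
proof (rule ell2_eqI)
  fix p
  have bij: "bij (map_positions n J \<tau>)" for J
    by (rule involuntory_imp_bij) (rule map_positions_involution[OF assms])
  have "coord x p - coord x (map_positions n {j} \<tau> p)
      = (if j = p mod n then coord x p - coord x (map_positions n UNIV \<tau> p) else 0)" for j
    by (auto simp: map_positions_def)
  then show "coord (x - permute (map_positions n UNIV \<tau>) x) p
      = coord (\<Sum>j<n. x - permute (map_positions n {j} \<tau>) x) p"
    using assms(1) by (simp add: coord_sum coord_simps coord_permute[OF bij])
qed

lemma norm_sq_eq_sum_blocks:
  assumes "0 < n"
  shows "summable (\<lambda>k. (coord x (k * n + j))\<^sup>2)"
    and "(norm x)\<^sup>2 = (\<Sum>j<n. \<Sum>k. (coord x (k * n + j))\<^sup>2)"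
proof -
  have summable: "summable (\<lambda>k. (coord x (k * n + j))\<^sup>2)" for j
    using summable_reindex[OF summable_coord_sq[of x], of "\<lambda>k. k * n + j"] assms
    by (simp add: inj_def o_def)
  show "summable (\<lambda>k. (coord x (k * n + j))\<^sup>2)" by (rule summable)
  have "(\<lambda>k. \<Sum>p\<in>{k * n..<k * n + n}. (coord x p)\<^sup>2) sums (norm x)\<^sup>2"
    unfolding norm_ell2_sq by (intro sums_group summable_sums summable_coord_sq assms)
  moreover have "(\<Sum>p\<in>{k * n..<k * n + n}. (coord x p)\<^sup>2) = (\<Sum>j<n. (coord x (k * n + j))\<^sup>2)" for k
    using sum.shift_bounds_nat_ivl[of "\<lambda>p. (coord x p)\<^sup>2" 0 "k * n" n]
    by (simp add: atLeast0LessThan add.commute)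
  ultimately show "(norm x)\<^sup>2 = (\<Sum>j<n. \<Sum>k. (coord x (k * n + j))\<^sup>2)"
    by (simp add: sums_iff suminf_sum[OF summable])
qed

definition geometric_blocks :: "nat \<Rightarrow> real \<Rightarrow> ell2" where
  "geometric_blocks n q = Abs_ell2 (\<lambda>p. q ^ (p div n))"

lemma coord_geometric_blocks:
  assumes "0 < n" "0 < q" "q < 1"
  shows "coord (geometric_blocks n q) p = q ^ (p div n)"
proof -
  have q2: "0 \<le> q\<^sup>2" "q\<^sup>2 < 1" using assms by (auto simp: power_less_one_iff)
  have "summable (\<lambda>p. (q ^ (p div n))\<^sup>2)"
  proof (rule summableI_nonneg_bounded)
    fix N
    have "(\<Sum>p<N. (q ^ (p div n))\<^sup>2) \<le> (\<Sum>p<N * n. (q ^ (p div n))\<^sup>2)"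
      using assms by (intro sum_mono2) auto
    also have "\<dots> = (\<Sum>k<N. \<Sum>p\<in>{k * n..<k * n + n}. (q ^ (p div n))\<^sup>2)"
      by (simp add: sum.nat_group)
    also have "\<dots> = (\<Sum>k<N. \<Sum>p\<in>{k * n..<k * n + n}. (q\<^sup>2) ^ k)"
    proof (intro sum.cong refl)
      fix k p assume "p \<in> {k * n..<k * n + n}"
      then have "p div n = k"
        by (intro div_nat_eqI) (auto simp: algebra_simps)
      then show "(q ^ (p div n))\<^sup>2 = (q\<^sup>2) ^ k" by (simp add: power_mult[symmetric] mult.commute)
    qed
    also have "\<dots> = real n * (\<Sum>k<N. (q\<^sup>2) ^ k)"
      by (simp add: sum_distrib_left)
    also have "\<dots> \<le> real n * (\<Sum>k. (q\<^sup>2) ^ k)"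
      using q2 by (intro mult_left_mono sum_le_suminf summable_geometric) auto
    finally show "(\<Sum>p<N. (q ^ (p div n))\<^sup>2) \<le> real n * (\<Sum>k. (q\<^sup>2) ^ k)" .
  qed simp
  then show ?thesis by (simp add: geometric_blocks_def coord_Abs)
qed

text \<open>
  Cutting block \<open>j\<close> of the geometric vector after \<open>d j\<close> positions loses the fraction \<open>q ^ (2 * d j)\<close>
  of its squared norm, and the relative squared error of the best such approximation is the average
  of these fractions. The average is bounded below through the tangent of \<open>exp\<close> at \<open>ln \<epsilon>\<close>, so an
  uneven distribution of the levels over the blocks does not help.
\<close>
lemma eps_solution_levels:
  assumes n: "0 < n" and q: "0 < q" "q < 1" and "0 < \<epsilon>"
    and x: "x \<in> below_levels n d" and sol: "eps_solution \<epsilon> (geometric_blocks n q) x"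
  shows "real n * ln (1 / \<epsilon>) \<le> 2 * ln (1 / q) * (\<Sum>j<n. real (d j))"
proof -
  let ?g = "geometric_blocks n q"
  let ?s = "\<Sum>k. (q\<^sup>2) ^ k"
  have q2: "0 < q\<^sup>2" "q\<^sup>2 < 1" using q by (auto simp: power_less_one_iff)
  then have geom: "summable (\<lambda>k. (q\<^sup>2) ^ k)" by (intro summable_geometric) auto
  then have s: "0 < ?s" using q2 by (intro suminf_pos) auto
  have block: "(q\<^sup>2) ^ d j * ?s \<le> (\<Sum>k. (coord (x - ?g) (k * n + j))\<^sup>2)" if j: "j < n" for j
  proof -
    note blk = norm_sq_eq_sum_blocks(1)[OF n, of "x - ?g" j]
    have "coord x ((k + d j) * n + j) = 0" for k
      using x j n unfolding below_levels_def supported_in_def by simp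
    then have "(coord (x - ?g) ((k + d j) * n + j))\<^sup>2 = (q\<^sup>2) ^ d j * (q\<^sup>2) ^ k" for k
      using n q j by (simp add: coord_simps coord_geometric_blocks power_add power_mult_distrib
          mult.commute flip: power_mult)
    then have "(q\<^sup>2) ^ d j * ?s = (\<Sum>k. (coord (x - ?g) ((k + d j) * n + j))\<^sup>2)"
      using geom by (simp add: suminf_mult)
    also have "\<dots> \<le> (\<Sum>k. (coord (x - ?g) (k * n + j))\<^sup>2)"
      unfolding suminf_minus_initial_segment[OF blk] by (simp add: sum_nonneg)
    finally show ?thesis .
  qed
  have "(\<Sum>j<n. (q\<^sup>2) ^ d j * ?s) \<le> (norm (x - ?g))\<^sup>2"
    unfolding norm_sq_eq_sum_blocks(2)[OF n] using block by (intro sum_mono) auto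
  also have "\<dots> \<le> \<epsilon> * (norm ?g)\<^sup>2"
    using sol by (simp add: eps_solution_def)
  also have "(norm ?g)\<^sup>2 = (\<Sum>j<n. ?s)"
    unfolding norm_sq_eq_sum_blocks(2)[OF n] using n q
    by (intro sum.cong) (simp_all add: coord_geometric_blocks mult.commute flip: power_mult)
  finally have "(\<Sum>j<n. (q\<^sup>2) ^ d j) * ?s \<le> (\<epsilon> * real n) * ?s"
    by (simp add: sum_distrib_right)
  then have avg: "(\<Sum>j<n. (q\<^sup>2) ^ d j) \<le> \<epsilon> * real n"
    using s by simp
  have tangent: "\<epsilon> * (1 + 2 * ln q * real (d j) - ln \<epsilon>) \<le> (q\<^sup>2) ^ d j" for j
  proof -
    have "(q\<^sup>2) ^ d j = exp (2 * ln q * real (d j))"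
      using exp_of_nat_mult[of "2 * d j" "ln q"] q by (simp add: mult_ac flip: power_mult)
    also have "\<dots> = \<epsilon> * exp (2 * ln q * real (d j) - ln \<epsilon>)"
      using \<open>0 < \<epsilon>\<close> by (simp add: exp_diff)
    also have "\<dots> \<ge> \<epsilon> * (1 + (2 * ln q * real (d j) - ln \<epsilon>))"
      using \<open>0 < \<epsilon>\<close> by (intro mult_left_mono exp_ge_add_one_self) auto
    finally show ?thesis by (simp add: algebra_simps)
  qed
  have "\<epsilon> * (\<Sum>j<n. 1 + 2 * ln q * real (d j) - ln \<epsilon>) \<le> \<epsilon> * real n"
    unfolding sum_distrib_left
    by (rule order_trans[OF sum_mono avg]) (rule tangent)
  then have "(\<Sum>j<n. 1 + 2 * ln q * real (d j) - ln \<epsilon>) \<le> real n"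
    using \<open>0 < \<epsilon>\<close> by simp
  moreover have "(\<Sum>j<n. 1 + 2 * ln q * real (d j) - ln \<epsilon>)
      = real n + 2 * ln q * (\<Sum>j<n. real (d j)) - real n * ln \<epsilon>"
    unfolding sum_subtractf sum.distrib by (simp only: sum_distrib_left[symmetric]) simp
  moreover have "ln (1 / \<epsilon>) = - ln \<epsilon>" "ln (1 / q) = - ln q"
    using q \<open>0 < \<epsilon>\<close> by (simp_all add: ln_div)
  ultimately show ?thesis by simp
qed

section \<open>Stars as gossip networks\<close>

definition star_graph :: "nat \<Rightarrow> nat \<Rightarrow> (nat \<times> nat) set" where
  "star_graph m c = {(i, j). i < m \<and> j < m \<and> i \<noteq> j \<and> (i = c \<or> j = c)}"

text \<open>The graph Laplacian of the star, divided by its largest eigenvalue \<open>m\<close>.\<close>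
definition star_weights :: "nat \<Rightarrow> nat \<Rightarrow> nat \<Rightarrow> nat \<Rightarrow> real" where
  "star_weights m c i j =
     (if i = j then if i = c then 1 - 1 / real m else 1 / real m
      else if i = c \<or> j = c then - (1 / real m) else 0)"

lemma network_stars: "network m (\<lambda>t. star_graph m (c t))"
  by (auto simp: network_def star_graph_def sym_def irrefl_def)

lemma mat_apply_star:
  fixes x :: "nat \<Rightarrow> 'a::real_vector"
  assumes "c < m" "i < m"
  shows "mat_apply m (star_weights m c) x i =
    (if i = c then x c - (1 / real m) *\<^sub>R (\<Sum>j<m. x j) else (1 / real m) *\<^sub>R (x i - x c))"
proof -
  let ?\<delta> = "\<lambda>i j. if j = i then x j else 0"
  have "star_weights m c i j *\<^sub>R x j = (if i = c then ?\<delta> c j - (1 / real m) *\<^sub>R x j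
      else (1 / real m) *\<^sub>R (?\<delta> i j - ?\<delta> c j))" for j
    by (auto simp: star_weights_def algebra_simps)
  then show ?thesis
    using assms unfolding mat_apply_def
    by (simp add: sum_subtractf scaleR_sum_right[symmetric] del: scaleR_sum_right)
qed

lemma norm_sq_convex_combination:
  fixes u v :: "'a::real_inner"
  assumes "0 \<le> r" "r \<le> 1"
  shows "(norm ((1 - r) *\<^sub>R u + r *\<^sub>R v))\<^sup>2 \<le> (1 - r) * (norm u)\<^sup>2 + r * (norm v)\<^sup>2"
proof -
  have "(1 - r) * (norm u)\<^sup>2 + r * (norm v)\<^sup>2 - (norm ((1 - r) *\<^sub>R u + r *\<^sub>R v))\<^sup>2
      = r * (1 - r) * (norm (u - v))\<^sup>2"
    unfolding power2_norm_eq_inner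
    by (simp add: inner_add_left inner_add_right inner_diff_left inner_diff_right inner_commute[of v u])
      algebra
  moreover have "0 \<le> r * (1 - r) * (norm (u - v))\<^sup>2"
    using assms by simp
  ultimately show ?thesis by linarith
qed

text \<open>
  Away from the centre, one step of \<open>I - W\<close> replaces \<open>x i\<close> by a convex combination with weight
  \<open>1 / m\<close> on the centre, and at the centre it vanishes on vectors of sum zero. The \<open>m - 1\<close> copies
  of the centre's weight add up to exactly \<open>1 - 1 / m\<close>.
\<close>
lemma gossip_star:
  assumes m: "2 \<le> m" and c: "c < m" and chi: "real m \<le> chi"
  shows "gossip chi m (star_graph m c) (star_weights m c)"
  unfolding gossip_def
proof (intro conjI allI impI)
  show "(star_weights m c i j \<noteq> 0) = ((i, j) \<in> star_graph m c \<or> i = j)" if "i < m" "j < m" for i j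
    using that m by (auto simp: star_weights_def star_graph_def)
  show "mat_apply m (star_weights m c) (\<lambda>_. s) i = 0" if "i < m" for s :: real and i
    using that c by (simp add: mat_apply_star)
  show "(\<Sum>i<m. mat_apply m (star_weights m c) y i) = 0" for y :: "nat \<Rightarrow> real"
  proof -
    have "(\<Sum>i<m. mat_apply m (star_weights m c) y i)
        = (\<Sum>i<m. (if i = c then y c - (1 / real m) * (\<Sum>j<m. y j) else 0) + (1 / real m) * (y i - y c))"
      using c by (intro sum.cong) (auto simp: mat_apply_star)
    also have "\<dots> = 0"
      using c by (simp add: sum.distrib sum_subtractf flip: sum_distrib_left sum_divide_distrib)
        (simp add: field_simps)
    finally show ?thesis .
  qed
  show "(\<Sum>i<m. (norm (mat_apply m (star_weights m c) x i - x i))\<^sup>2) \<le> (1 - 1 / chi) * (\<Sum>i<m. (norm (x i))\<^sup>2)"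
    if zero: "(\<Sum>i<m. x i) = 0" for x :: "nat \<Rightarrow> ell2"
  proof -
    let ?r = "1 / real m"
    have r: "0 \<le> ?r" "?r \<le> 1" using m by auto
    have "(norm (mat_apply m (star_weights m c) x i - x i))\<^sup>2
        \<le> (1 - ?r) * (norm (x i))\<^sup>2 + ?r * (norm (x c))\<^sup>2 - (if i = c then (norm (x c))\<^sup>2 else 0)"
      if i: "i < m" for i
    proof (cases "i = c")
      case True
      then show ?thesis using c zero by (simp add: mat_apply_star algebra_simps)
    next
      case False
      then have "mat_apply m (star_weights m c) x i - x i = - ((1 - ?r) *\<^sub>R x i + ?r *\<^sub>R x c)"
        using c i by (simp add: mat_apply_star algebra_simps)
      then show ?thesis
        using norm_sq_convex_combination[OF r, of "x i" "x c"] False by (simp only: norm_minus_cancel) simp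
    qed
    then have "(\<Sum>i<m. (norm (mat_apply m (star_weights m c) x i - x i))\<^sup>2)
        \<le> (\<Sum>i<m. (1 - ?r) * (norm (x i))\<^sup>2 + ?r * (norm (x c))\<^sup>2 - (if i = c then (norm (x c))\<^sup>2 else 0))"
      by (intro sum_mono) auto
    also have "\<dots> = (1 - ?r) * (\<Sum>i<m. (norm (x i))\<^sup>2)"
      using c m by (simp add: sum.distrib sum_subtractf flip: sum_distrib_left)
    also have "\<dots> \<le> (1 - 1 / chi) * (\<Sum>i<m. (norm (x i))\<^sup>2)"
      using m chi by (intro mult_right_mono sum_nonneg) (auto simp: field_simps)
    finally show ?thesis .
  qed
qed

text \<open>On two nodes the normalized Laplacian is the orthogonal projection onto the sum-zero vectors.\<close>
lemma gossip_two_nodes: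
  assumes "1 \<le> chi"
  shows "gossip chi 2 (star_graph 2 0) (star_weights 2 0)"
  unfolding gossip_def
proof (intro conjI allI impI)
  have sum2: "(\<Sum>i<2. g i) = g 0 + g 1" for g :: "nat \<Rightarrow> 'b::comm_monoid_add"
    by (simp add: numeral_2_eq_2)
  show "(star_weights 2 0 i j \<noteq> 0) = ((i, j) \<in> star_graph 2 0 \<or> i = j)" if "i < 2" "j < 2" for i j
    using that by (auto simp: star_weights_def star_graph_def)
  show "mat_apply 2 (star_weights 2 0) (\<lambda>_. s) i = 0" if "i < 2" for s :: real and i
    using that by (simp add: mat_apply_star)
  show "(\<Sum>i<2. mat_apply 2 (star_weights 2 0) y i) = 0" for y :: "nat \<Rightarrow> real"
    by (simp add: sum2 mat_apply_star field_simps)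
  show "(\<Sum>i<2. (norm (mat_apply 2 (star_weights 2 0) x i - x i))\<^sup>2) \<le> (1 - 1 / chi) * (\<Sum>i<2. (norm (x i))\<^sup>2)"
    if zero: "(\<Sum>i<2. x i) = 0" for x :: "nat \<Rightarrow> ell2"
  proof -
    have x1: "x 1 = - x 0"
      using zero unfolding sum2 by (rule minus_unique[symmetric])
    have "mat_apply 2 (star_weights 2 0) x i - x i = 0" if i: "i < 2" for i
    proof (cases "i = 0")
      case True
      then show ?thesis using zero by (simp add: mat_apply_star)
    next
      case False
      then have "i = 1" using i by simp
      moreover have "mat_apply 2 (star_weights 2 0) x 1 = (1 / 2) *\<^sub>R (x 1 + x 1)"
        using x1 by (simp add: mat_apply_star)
      ultimately show ?thesis by (simp add: scaleR_half_double)
    qed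
    then show ?thesis using assms by (simp add: sum_nonneg)
  qed
qed

section \<open>The hard problem\<close>

text \<open>
  There are \<open>M + 2\<close> nodes. Node \<open>0\<close> and node \<open>M + 1\<close> each hold every second edge of a path on the
  positions of every block, and the linear term sits at position \<open>0\<close> of node \<open>0\<close>; the nodes in
  between only relay. The condition numbers are relative to each node's own convexity constant,
  so the relays may be given a constant that adds up to \<open>1\<close> over all of them.
\<close>
locale hard_instance =
  fixes n M :: nat and q :: real
  assumes n: "0 < n" and M: "0 < M" and q: "0 < q" "q < 1"
begin

text \<open>
  The path weight making \<open>q\<close> the decaying root of the recurrence
  \<open>3 * x k + path_weight * (2 * x k - x (k - 1) - x (k + 1)) = 0\<close>, where \<open>3\<close> is the sum of the
  convexity constants.
\<close>
definition path_weight :: real where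
  "path_weight = 3 * q / (1 - q)\<^sup>2"

text \<open>
  The other end of the edge at position \<open>k\<close>. Node \<open>0\<close> has no edge at position \<open>0\<close>; there
  \<open>0 - 1 = 0\<close> makes the position its own mate.
\<close>
definition mate :: "nat \<Rightarrow> nat \<Rightarrow> nat" where
  "mate i k =
     (if i = 0 then if odd k then Suc k else k - 1
      else if i = Suc M then if even k then Suc k else k - 1 else k)"

definition swap :: "nat \<Rightarrow> nat set \<Rightarrow> ell2 \<Rightarrow> ell2" where
  "swap i J = permute (map_positions n J (mate i))"

definition convexity :: "nat \<Rightarrow> real" where
  "convexity i = (if i = 0 \<or> i = Suc M then 1 else 1 / real M)"

definition weight :: "nat \<Rightarrow> real" where
  "weight i = (if i = 0 \<or> i = Suc M then path_weight else 0)"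

definition source :: "nat \<Rightarrow> nat \<Rightarrow> ell2" where
  "source i j = (if i = 0 then (real n * (3 + path_weight * (1 - q))) *\<^sub>R unit_vector j else 0)"

definition node_source :: "nat \<Rightarrow> ell2" where
  "node_source i = (1 / real n) *\<^sub>R (\<Sum>j<n. source i j)"

definition f :: "nat \<Rightarrow> nat \<Rightarrow> ell2 \<Rightarrow> real" where
  "f i j = reflected_quadratic (swap i {j}) (convexity i) (real n * weight i) (source i j)"

lemma mate_involution: "mate i (mate i k) = k"
  by (cases k) (auto simp: mate_def)

lemma mate_le: "mate i k \<le> Suc k"
  by (auto simp: mate_def)

lemma mate_less:
  assumes "k < l" "i = 0 \<Longrightarrow> odd l" "i = Suc M \<Longrightarrow> even l"
  shows "mate i k < l"
proof (cases "Suc k = l")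
  case True
  then show ?thesis using assms by (cases "i = 0") (auto simp: mate_def)
next
  case False
  then show ?thesis using assms(1) mate_le[of i k] by simp
qed

lemma path_weight_pos: "0 < path_weight"
  using q by (simp add: path_weight_def)

lemma weight_nonneg: "0 \<le> weight i"
  using path_weight_pos by (simp add: weight_def)

lemma convexity_pos: "0 < convexity i"
  using M by (simp add: convexity_def)

lemma map_mate_involution: "map_positions n J (mate i) (map_positions n J (mate i) p) = p"
  by (rule map_positions_involution[OF n mate_involution])

lemma reflection_swap: "reflection (swap i J)"
  unfolding swap_def by (rule reflection_permute) (rule map_mate_involution)

lemma coord_swap: "coord (swap i J x) p = coord x (map_positions n J (mate i) p)"
  unfolding swap_def by (rule coord_permute, rule involuntory_imp_bij) (rule map_mate_involution)

lemma local_objective_eq: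
  "local_objective n f i = reflected_quadratic (swap i UNIV) (convexity i) (weight i) (node_source i)"
proof
  fix x
  show "local_objective n f i x
      = reflected_quadratic (swap i UNIV) (convexity i) (weight i) (node_source i) x"
    unfolding local_objective_def f_def
  proof (rule average_reflected_quadratics[OF n])
    show "y - swap i UNIV y = (\<Sum>j<n. y - swap i {j} y)" for y
      unfolding swap_def by (rule minus_permute_eq_sum_blocks[OF n mate_involution])
  qed (rule node_source_def)
qed

text \<open>
  At the two end nodes the ratio for a single \<open>f i j\<close> is \<open>1 + 2 * n * path_weight\<close>, because each \<open>f i j\<close> carries its
  block with the factor \<open>n\<close> that averaging removes.
\<close>
lemma decentralized:
  assumes \<kappa>b: "1 + 2 * path_weight \<le> \<kappa>b" and chi: "real (M + 2) \<le> chi" and c: "\<And>t. c t < M + 2"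
  shows "decentralized_problem n chi \<kappa>b (real n * \<kappa>b) (M + 2)
    (\<lambda>t. star_graph (M + 2) (c t)) (\<lambda>t. star_weights (M + 2) (c t)) f"
  unfolding decentralized_problem_def
proof (intro conjI allI impI exI)
  show "1 \<le> M + 2" by simp
  show "network (M + 2) (\<lambda>t. star_graph (M + 2) (c t))" by (rule network_stars)
  show "gossip chi (M + 2) (star_graph (M + 2) (c t)) (star_weights (M + 2) (c t))" for t
    using chi by (intro gossip_star c) auto
  have nonneg: "0 \<le> convexity i" "0 \<le> real n * weight i" for i
    using convexity_pos[of i] weight_nonneg[of i] by auto
  show "convex_on UNIV (f i j)" for i j
    unfolding f_def by (rule reflection.reflected_quadratic_convex[OF reflection_swap nonneg])
  show "smooth (convexity i + 2 * (real n * weight i)) (f i j)" for i j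
    unfolding f_def by (rule reflection.reflected_quadratic_smooth[OF reflection_swap nonneg])
  show "0 < convexity i" for i by (rule convexity_pos)
  show "strongly_convex (convexity i) (local_objective n f i)" for i
    unfolding local_objective_eq
    by (rule reflection.reflected_quadratic_strongly_convex[OF reflection_swap weight_nonneg])
  show "smooth (convexity i + 2 * weight i) (local_objective n f i)" for i
    unfolding local_objective_eq
    by (rule reflection.reflected_quadratic_smooth[OF reflection_swap nonneg(1) weight_nonneg])
  have one: "1 \<le> \<kappa>b" using \<kappa>b path_weight_pos by linarith
  show "(convexity i + 2 * weight i) / convexity i \<le> \<kappa>b" for i
    using \<kappa>b one M by (simp add: convexity_def weight_def)
  have "1 + 2 * (real n * path_weight) \<le> real n * \<kappa>b"
  proof -
    have "1 + 2 * (real n * path_weight) \<le> real n * (1 + 2 * path_weight)"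
      using n by (simp add: algebra_simps)
    also have "\<dots> \<le> real n * \<kappa>b" using \<kappa>b by (intro mult_left_mono) auto
    finally show ?thesis .
  qed
  moreover have "1 \<le> real n * \<kappa>b"
    using mult_mono[of 1 "real n" 1 \<kappa>b] n one by simp
  ultimately show "1 / real n * (\<Sum>j<n. (convexity i + 2 * (real n * weight i)) / convexity i) \<le> real n * \<kappa>b" for i
    using n M by (simp add: convexity_def weight_def)
qed

lemma coord_node_source:
  "coord (node_source i) p = (if i = 0 \<and> p < n then 3 + path_weight * (1 - q) else 0)"
proof (cases "i = 0")
  case True
  then show ?thesis
    using n by (simp add: node_source_def source_def coord_simps coord_sum coord_unit_vector
        flip: sum_distrib_left)
next
  case False
  then show ?thesis by (simp add: node_source_def source_def coord_simps)
qed

lemma gradient_at_geometric_blocks: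
  "(\<Sum>i<M + 2. reflected_gradient (swap i UNIV) (convexity i) (weight i) (node_source i)
      (geometric_blocks n q)) = 0"
proof (rule ell2_eqI)
  fix p
  define k where "k = p div n"
  define g where "g i = convexity i * q ^ k + weight i * (q ^ k - q ^ mate i k)
      - coord (node_source i) p" for i
  have "coord (\<Sum>i<M + 2. reflected_gradient (swap i UNIV) (convexity i) (weight i) (node_source i)
      (geometric_blocks n q)) p = (\<Sum>i<M + 2. g i)"
    using n q by (simp add: coord_sum coord_simps reflected_gradient_def coord_swap g_def k_def
        coord_geometric_blocks map_positions_div)
  also have "\<dots> = g 0 + (\<Sum>i<M. g (Suc i)) + g (Suc M)"
    unfolding add_2_eq_Suc' sum.lessThan_Suc_shift[of g] sum.lessThan_Suc[of "\<lambda>i. g (Suc i)"] add.assoc ..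
  also have "(\<Sum>i<M. g (Suc i)) = (\<Sum>i<M. 1 / real M * q ^ k)"
    by (intro sum.cong) (auto simp: g_def convexity_def weight_def coord_node_source)
  also have "g 0 + (\<Sum>i<M. 1 / real M * q ^ k) + g (Suc M)
      = 3 * q ^ k + path_weight * (2 * q ^ k - q ^ mate 0 k - q ^ mate (Suc M) k)
        - coord (node_source 0) p"
    using M by (simp add: g_def convexity_def weight_def coord_node_source algebra_simps)
  also have "\<dots> = 0"
  proof (cases k)
    case 0
    then have "p < n" using n by (simp add: k_def div_eq_0_iff)
    then show ?thesis using 0 M by (simp add: mate_def coord_node_source algebra_simps)
  next
    case (Suc l)
    then have p: "\<not> p < n" by (auto simp: k_def)
    have mates: "q ^ mate 0 k + q ^ mate (Suc M) k = q ^ l + q ^ (l + 2)"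
      using Suc by (cases "even k") (simp_all add: mate_def)
    have "path_weight * (1 - q)\<^sup>2 = 3 * q"
      using q by (simp add: path_weight_def)
    then have "q ^ l * (3 * q - path_weight * (1 - q)\<^sup>2) = 0" by simp
    then have "3 * q ^ k + path_weight * (2 * q ^ k - (q ^ l + q ^ (l + 2))) = 0"
      using Suc by (simp add: algebra_simps power2_eq_square)
    then show ?thesis
      using p unfolding mates[symmetric] by (simp add: coord_node_source algebra_simps)
  qed
  finally show "coord (\<Sum>i<M + 2. reflected_gradient (swap i UNIV) (convexity i) (weight i)
      (node_source i) (geometric_blocks n q)) p = coord 0 p"
    by (simp add: coord_simps)
qed

lemma minimizer_geometric_blocks:
  "minimizer (\<lambda>x. \<Sum>i<M + 2. local_objective n f i x) (geometric_blocks n q)"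
  unfolding minimizer_def
proof
  fix y
  let ?x = "geometric_blocks n q"
  let ?D = "\<lambda>i. reflected_gradient (swap i UNIV) (convexity i) (weight i) (node_source i) ?x"
  have "local_objective n f i ?x + inner (?D i) (y - ?x) \<le> local_objective n f i y" for i
    unfolding local_objective_eq
    using reflection.reflected_quadratic_first_order[OF reflection_swap less_imp_le[OF convexity_pos]
        weight_nonneg] .
  then have "(\<Sum>i<M + 2. local_objective n f i ?x + inner (?D i) (y - ?x)) \<le> (\<Sum>i<M + 2. local_objective n f i y)"
    by (intro sum_mono) auto
  then show "(\<Sum>i<M + 2. local_objective n f i ?x) \<le> (\<Sum>i<M + 2. local_objective n f i y)"
    unfolding sum.distrib inner_sum_left[symmetric] gradient_at_geometric_blocks by simp
qed

section \<open>How information spreads\<close>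

text \<open>The linear term touches no edge of its own node: position \<open>0\<close> has no mate at node \<open>0\<close>.\<close>
lemma swap_source:
  assumes "j < n"
  shows "swap i {j} (source i j) = source i j"
proof (rule ell2_eqI)
  fix p
  show "coord (swap i {j} (source i j)) p = coord (source i j) p"
  proof (cases "i = 0")
    case True
    have fixed: "map_positions n {j} (mate 0) j = j"
      using assms by (simp add: map_positions_def mate_def)
    then have "map_positions n {j} (mate 0) p = j \<longleftrightarrow> p = j"
      by (metis map_mate_involution)
    then show ?thesis
      using True by (simp add: coord_swap source_def coord_simps coord_unit_vector)
  next
    case False
    then show ?thesis by (simp add: coord_swap source_def coord_simps)
  qed
qed

text \<open>A call with index \<open>j\<close> moves coordinates within block \<open>j\<close> alone, so only that level can grow.\<close>
lemma oracle_answer_below_levels: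
  assumes answer: "oracle_answer (f i) c y" and j: "index c < n"
    and point: "point c \<in> below_levels n d" and le: "\<And>j. d j \<le> e j"
    and grow: "\<And>k. k < d (index c) \<Longrightarrow> mate i k < e (index c)"
    and src: "i = 0 \<Longrightarrow> 0 < e (index c)"
  shows "y \<in> below_levels n e"
proof (rule reflection.reflected_quadratic_oracle_answer[OF reflection_swap answer])
  let ?j = "index c"
  show "f i ?j = reflected_quadratic (swap i {?j}) (convexity i) (real n * weight i) (source i ?j)"
    by (simp add: f_def)
  show "subspace (below_levels n e)" by (rule subspace_below_levels)
  show "below_levels n d \<subseteq> below_levels n e" by (rule below_levels_mono) (rule le)
  show "swap i {?j} ` below_levels n d \<subseteq> below_levels n e"
    unfolding swap_def by (rule permute_below_levels[OF n mate_involution]) (use grow le in auto)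
  show "source i ?j \<in> below_levels n e"
    using j src by (auto simp: below_levels_def supported_in_def source_def coord_simps coord_unit_vector)
  show "swap i {?j} (source i ?j) = source i ?j" by (rule swap_source[OF j])
  show "point c \<in> below_levels n d" by (rule point)
  show "0 < convexity i" by (rule convexity_pos)
  show "0 \<le> real n * weight i" using weight_nonneg by simp
qed

lemma computation_below_levels:
  assumes run: "first_order_run n (M + 2) G f comm H Q out" and i: "i < M + 2" and k: "\<not> comm k"
    and H: "H i k \<subseteq> below_levels n d" and le: "\<And>j. d j \<le> e j"
    and grow: "\<And>c l. c \<in> Q i k \<Longrightarrow> l < d (index c) \<Longrightarrow> mate i l < e (index c)"
    and src: "\<And>c. i = 0 \<Longrightarrow> c \<in> Q i k \<Longrightarrow> 0 < e (index c)"
  shows "H i (Suc k) \<subseteq> below_levels n e"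
proof -
  have calls: "\<And>c. c \<in> Q i k \<Longrightarrow> index c < n \<and> point c \<in> H i k"
    and span: "H i (Suc k) \<subseteq> span (H i k \<union> {d. \<exists>c\<in>Q i k. oracle_answer (f i) c d})"
    using run i k unfolding first_order_run_def by blast+
  have "y \<in> below_levels n e" if "c \<in> Q i k" "oracle_answer (f i) c y" for c y
    using oracle_answer_below_levels[OF that(2)] calls[OF that(1)] H le grow[OF that(1)] src[OF _ that(1)]
    by blast
  moreover have "H i k \<subseteq> below_levels n e"
    using H below_levels_mono[of d e n] le by blast
  ultimately have "span (H i k \<union> {d. \<exists>c\<in>Q i k. oracle_answer (f i) c d}) \<subseteq> below_levels n e"
    by (intro span_minimal subspace_below_levels) auto
  with span show ?thesis by blast
qed

lemma communication_below_levels: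
  assumes run: "first_order_run n (M + 2) G f comm H Q out" and i: "i < M + 2" and k: "comm k"
    and H: "\<And>j. j = i \<or> (i, j) \<in> G (comm_count comm k) \<Longrightarrow> H j k \<subseteq> below_levels n d"
  shows "H i (Suc k) \<subseteq> below_levels n d"
proof -
  have "H i (Suc k) \<subseteq> span ((\<Union>j\<in>{j. (i, j) \<in> G (comm_count comm k)}. H j k) \<union> H i k)"
    using run i k unfolding first_order_run_def by blast
  also have "\<dots> \<subseteq> below_levels n d"
    using H by (intro span_minimal subspace_below_levels) blast
  finally show ?thesis .
qed

lemma initial_below_levels:
  assumes "first_order_run n (M + 2) G f comm H Q out" "i < M + 2"
  shows "H i 0 \<subseteq> below_levels n d"
  using assms subspace_0[OF subspace_below_levels] unfolding first_order_run_def by auto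

subsection \<open>Oracle calls\<close>

definition block_calls :: "(nat \<Rightarrow> bool) \<Rightarrow> (nat \<Rightarrow> nat \<Rightarrow> ell2 oracle_call set) \<Rightarrow> nat \<Rightarrow> nat \<Rightarrow> nat" where
  "block_calls comm Q k j = card {c \<in> oracle_calls comm Q 0 k. index (snd c) = j}"

lemma oracle_calls_mono: "k \<le> l \<Longrightarrow> oracle_calls comm Q i k \<subseteq> oracle_calls comm Q i l"
  by (auto simp: oracle_calls_def)

lemma block_calls_mono:
  assumes "finite (oracle_calls comm Q 0 l)" "k \<le> l"
  shows "block_calls comm Q k j \<le> block_calls comm Q l j"
  unfolding block_calls_def using assms oracle_calls_mono[of k l]
  by (intro card_mono finite_subset[OF _ assms(1)]) auto

lemma block_calls_Suc:
  assumes fin: "finite (oracle_calls comm Q 0 (Suc k))" and "\<not> comm k" "c \<in> Q 0 k"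
  shows "block_calls comm Q k (index c) < block_calls comm Q (Suc k) (index c)"
  unfolding block_calls_def
proof (rule psubset_card_mono)
  let ?B = "\<lambda>k. {b \<in> oracle_calls comm Q 0 k. index (snd b) = index c}"
  show "finite (?B (Suc k))" using fin by simp
  have "(k, c) \<in> ?B (Suc k)" "(k, c) \<notin> ?B k"
    using assms by (auto simp: oracle_calls_def)
  then show "?B k \<subset> ?B (Suc k)"
    using oracle_calls_mono[of k "Suc k"] by fastforce
qed

lemma sum_block_calls_le:
  assumes "finite (oracle_calls comm Q 0 K)"
  shows "(\<Sum>j<n. block_calls comm Q K j) \<le> card (oracle_calls comm Q 0 K)"
proof -
  let ?C = "oracle_calls comm Q 0 K"
  have "(\<Sum>j<n. block_calls comm Q K j) = card (\<Union>j<n. {c \<in> ?C. index (snd c) = j})"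
    unfolding block_calls_def using assms by (subst card_UN_disjoint) auto
  also have "\<dots> \<le> card ?C"
    using assms by (intro card_mono) auto
  finally show ?thesis .
qed

text \<open>
  At an even level only node \<open>0\<close> can lengthen the support in block \<open>j\<close>, and only by calling
  \<open>f 0 j\<close>. Whatever happens elsewhere then adds one more position at most, because the next edge
  belongs to node \<open>0\<close> again.
\<close>
lemma memory_below_twice_block_calls:
  assumes run: "first_order_run n (M + 2) G f comm H Q out"
    and G: "network (M + 2) G" and fin: "finite (oracle_calls comm Q 0 K)"
  shows "k \<le> K \<Longrightarrow> i < M + 2 \<Longrightarrow> H i k \<subseteq> below_levels n (\<lambda>j. 2 * block_calls comm Q k j)"
proof (induction k arbitrary: i)
  case 0
  then show ?case using initial_below_levels[OF run] by blast
next
  case (Suc k)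
  let ?d = "\<lambda>j. 2 * block_calls comm Q k j" and ?e = "\<lambda>j. 2 * block_calls comm Q (Suc k) j"
  have fin': "finite (oracle_calls comm Q 0 (Suc k))"
    using fin oracle_calls_mono[OF Suc.prems(1)] by (rule finite_subset[rotated])
  have le: "?d j \<le> ?e j" for j
    using block_calls_mono[OF fin', of k] by simp
  have IH: "H j k \<subseteq> below_levels n ?d" if "j < M + 2" for j
    using Suc that by simp
  show ?case
  proof (cases "comm k")
    case True
    show ?thesis
    proof (rule communication_below_levels[OF run Suc.prems(2) True])
      fix j assume "j = i \<or> (i, j) \<in> G (comm_count comm k)"
      then have "j < M + 2"
        using G Suc.prems(2) unfolding network_def by auto
      then show "H j k \<subseteq> below_levels n ?e"
        using IH below_levels_mono[of ?d ?e n] le by blast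
    qed
  next
    case False
    show ?thesis
    proof (rule computation_below_levels[OF run Suc.prems(2) False IH[OF Suc.prems(2)] le])
      fix c l
      assume c: "c \<in> Q i k" and l: "l < ?d (index c)"
      show "mate i l < ?e (index c)"
      proof (cases "i = 0")
        case True
        then show ?thesis
          using block_calls_Suc[OF fin' False, of c] c l mate_le[of 0 l] by simp
      next
        case nz: False
        then show ?thesis
          using mate_less[OF l, of i] le[of "index c"] by auto
      qed
    next
      fix c
      assume "i = 0" "c \<in> Q i k"
      then show "0 < ?e (index c)"
        using block_calls_Suc[OF fin' False, of c] by simp
    qed
  qed
qed

lemma oracle_call_lower_bound:
  assumes run: "first_order_run n (M + 2) G f comm H Q out"
    and G: "network (M + 2) G" and fin: "finite (oracle_calls comm Q 0 K)"
    and "0 < \<epsilon>" and k: "k \<le> K" and sol: "eps_solution \<epsilon> (geometric_blocks n q) (out 0 k)"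
  shows "real n * ln (1 / \<epsilon>) \<le> 4 * ln (1 / q) * real (card (oracle_calls comm Q 0 K))"
proof -
  have "out 0 k \<in> below_levels n (\<lambda>j. 2 * block_calls comm Q k j)"
    using memory_below_twice_block_calls[OF run G fin k, of 0] run unfolding first_order_run_def by auto
  then have "out 0 k \<in> below_levels n (\<lambda>j. 2 * block_calls comm Q K j)"
    using below_levels_mono[of "\<lambda>j. 2 * block_calls comm Q k j" "\<lambda>j. 2 * block_calls comm Q K j" n]
      block_calls_mono[OF fin k] by auto
  from eps_solution_levels[OF n q \<open>0 < \<epsilon>\<close> this sol]
  have "real n * ln (1 / \<epsilon>) \<le> 4 * ln (1 / q) * real (\<Sum>j<n. block_calls comm Q K j)"
    by (simp add: sum_distrib_left mult.assoc)
  also have "\<dots> \<le> 4 * ln (1 / q) * real (card (oracle_calls comm Q 0 K))"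
    using sum_block_calls_le[OF fin] q by (intro mult_left_mono) (auto simp del: of_nat_sum)
  finally show ?thesis .
qed

subsection \<open>Communication rounds\<close>

definition rotating_center :: "nat \<Rightarrow> nat" where
  "rotating_center t = Suc (t mod M)"

lemma rotating_center_less: "rotating_center t < M + 2"
  using mod_less_divisor[OF M, of t] by (simp add: rotating_center_def)

text \<open>
  An upper bound on the level at node \<open>i\<close> after \<open>t\<close> rounds. During the \<open>s\<close>-th period of \<open>M\<close>
  rounds, level \<open>s + 1\<close> can be present only at the end node that produces it and at the relays that
  have been the centre in this period. A relay that becomes the centre still has level \<open>s\<close> and
  passes on nothing new, so the other end of the network has to wait for the next period.
\<close>
definition reached_level :: "nat \<Rightarrow> nat \<Rightarrow> nat" where
  "reached_level i t = t div M +
     (if i = (if even (t div M) then 0 else Suc M) \<or> 1 \<le> i \<and> i \<le> t mod M then 1 else 0)"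

lemma reached_level_parity: "odd (reached_level 0 t)" "even (reached_level (Suc M) t)"
  using mod_less_divisor[OF M, of t] by (auto simp: reached_level_def)

lemma reached_level_le: "reached_level i t \<le> Suc (t div M)"
  by (simp add: reached_level_def)

lemma reached_level_star:
  assumes "j = i \<or> (i, j) \<in> star_graph (M + 2) (rotating_center t)"
  shows "reached_level j t \<le> reached_level i (Suc t)"
proof (cases "Suc (t mod M) = M")
  case True
  \<comment> \<open>A new period begins, and its number alone already covers every level of the old one.\<close>
  then have "Suc t div M = Suc (t div M)" by (simp add: div_Suc mod_Suc)
  then show ?thesis
    using reached_level_le[of j t] by (simp add: reached_level_def)
next
  case False
  then have same: "Suc t div M = t div M" "Suc t mod M = Suc (t mod M)"
    by (simp_all add: div_Suc mod_Suc)
  have less: "t mod M < M" using M by simp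
  from assms consider "j = i" | "j = rotating_center t" | "i = rotating_center t"
    by (auto simp: star_graph_def)
  then show ?thesis
  proof cases
    case 1
    then show ?thesis using same by (auto simp: reached_level_def)
  next
    case 2
    then have "reached_level j t = t div M"
      using less by (simp add: reached_level_def rotating_center_def)
    then show ?thesis using same by (simp add: reached_level_def)
  next
    case 3
    then have "reached_level i (Suc t) = Suc (t div M)"
      using same by (simp add: reached_level_def rotating_center_def)
    then show ?thesis using reached_level_le[of j t] by simp
  qed
qed

lemma comm_count_Suc: "comm_count comm (Suc k) = comm_count comm k + (if comm k then 1 else 0)"
proof -
  have "{l. l < Suc k \<and> comm l} = (if comm k then insert k else id) {l. l < k \<and> comm l}"
    by (auto simp: less_Suc_eq)
  then show ?thesis by (simp add: comm_count_def)
qed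

lemma comm_count_mono: "k \<le> l \<Longrightarrow> comm_count comm k \<le> comm_count comm l"
  unfolding comm_count_def by (intro card_mono) auto

lemma memory_below_reached_level:
  assumes run: "first_order_run n (M + 2) (\<lambda>t. star_graph (M + 2) (rotating_center t)) f comm H Q out"
  shows "i < M + 2 \<Longrightarrow> H i k \<subseteq> below_levels n (\<lambda>_. reached_level i (comm_count comm k))"
proof (induction k arbitrary: i)
  case 0
  then show ?case using initial_below_levels[OF run] by blast
next
  case (Suc k)
  let ?t = "comm_count comm k"
  show ?case
  proof (cases "comm k")
    case True
    show ?thesis
    proof (rule communication_below_levels[OF run Suc.prems True])
      fix j assume j: "j = i \<or> (i, j) \<in> star_graph (M + 2) (rotating_center ?t)"
      then have "j < M + 2" using Suc.prems by (auto simp: star_graph_def)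
      then have "H j k \<subseteq> below_levels n (\<lambda>_. reached_level j ?t)" by (rule Suc.IH)
      also have "\<dots> \<subseteq> below_levels n (\<lambda>_. reached_level i (comm_count comm (Suc k)))"
        using reached_level_star[OF j] True by (intro below_levels_mono) (simp add: comm_count_Suc)
      finally show "H j k \<subseteq> below_levels n (\<lambda>_. reached_level i (comm_count comm (Suc k)))" .
    qed
  next
    case False
    then have "comm_count comm (Suc k) = ?t" by (simp add: comm_count_Suc)
    moreover have "H i (Suc k) \<subseteq> below_levels n (\<lambda>_. reached_level i ?t)"
    proof (rule computation_below_levels[OF run Suc.prems False Suc.IH[OF Suc.prems]])
      show "mate i l < reached_level i ?t" if "l < reached_level i ?t" for l
        using that reached_level_parity by (intro mate_less) auto
      show "0 < reached_level i ?t" if "i = 0"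
        using that reached_level_parity(1)[of ?t] by (simp add: odd_pos)
    qed simp
    ultimately show ?thesis by simp
  qed
qed

lemma communication_lower_bound:
  assumes run: "first_order_run n (M + 2) (\<lambda>t. star_graph (M + 2) (rotating_center t)) f comm H Q out"
    and "0 < \<epsilon>" and k: "k \<le> K" and sol: "eps_solution \<epsilon> (geometric_blocks n q) (out 0 k)"
  shows "ln (1 / \<epsilon>) \<le> 2 * ln (1 / q) * (real (comm_count comm K) / real M + 1)"
proof -
  let ?l = "reached_level 0 (comm_count comm k)"
  have "out 0 k \<in> below_levels n (\<lambda>_. ?l)"
    using memory_below_reached_level[OF run, of 0 k] run unfolding first_order_run_def by auto
  from eps_solution_levels[OF n q \<open>0 < \<epsilon>\<close> this sol]
  have "real n * ln (1 / \<epsilon>) \<le> real n * (2 * ln (1 / q) * real ?l)"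
    by (simp add: algebra_simps)
  then have "ln (1 / \<epsilon>) \<le> 2 * ln (1 / q) * real ?l" using n by simp
  also have "\<dots> \<le> 2 * ln (1 / q) * (real (comm_count comm K) / real M + 1)"
  proof (rule mult_left_mono)
    have "real ?l \<le> real (comm_count comm k div M) + 1"
      using reached_level_le[of 0 "comm_count comm k"] by linarith
    also have "real (comm_count comm k div M) \<le> real (comm_count comm k) / real M"
      by (simp add: of_nat_div_le_of_nat)
    also have "\<dots> \<le> real (comm_count comm K) / real M"
      using comm_count_mono[OF k, of comm] by (simp add: divide_right_mono)
    finally show "real ?l \<le> real (comm_count comm K) / real M + 1" by simp
  qed (use q in simp)
  finally show ?thesis .
qed

end

section \<open>The lower bound\<close>

text \<open>
  For small \<open>chi\<close> or \<open>\<kappa>b\<close> only the existence of a problem is claimed. It takes two nodes: on a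
  single node the kernel condition forces the only entry of \<open>W\<close> to vanish, and the sparsity pattern
  forbids that.
\<close>
lemma trivial_problem:
  assumes "1 \<le> n" "1 \<le> chi" "1 \<le> \<kappa>b"
  shows "decentralized_problem n chi \<kappa>b 1 2 (\<lambda>_. star_graph 2 0) (\<lambda>_. star_weights 2 0)
      (\<lambda>_ _. reflected_quadratic id 1 0 0)"
    and "minimizer (\<lambda>x. \<Sum>i<2. local_objective n (\<lambda>_ _. reflected_quadratic id 1 0 0) i x) (0::ell2)"
proof -
  let ?f = "reflected_quadratic id 1 0 0 :: ell2 \<Rightarrow> real"
  interpret reflection "id :: ell2 \<Rightarrow> ell2"
    by (rule reflection.intro) (simp_all add: linear_id)
  have local: "local_objective n (\<lambda>_ _. ?f) i = ?f" for i
    using assms(1) by (simp add: local_objective_def fun_eq_iff)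
  have smooth: "smooth 1 ?f" using reflected_quadratic_smooth[of 1 0 0] by simp
  show "decentralized_problem n chi \<kappa>b 1 2 (\<lambda>_. star_graph 2 0) (\<lambda>_. star_weights 2 0) (\<lambda>_ _. ?f)"
    unfolding decentralized_problem_def local
    using assms smooth network_stars gossip_two_nodes
    by (intro conjI exI[of _ "\<lambda>_ _. 1"] exI[of _ "\<lambda>_. 1"] allI impI)
      (simp_all add: reflected_quadratic_convex reflected_quadratic_strongly_convex)
  show "minimizer (\<lambda>x. \<Sum>i<2. local_objective n (\<lambda>_ _. ?f) i x) 0"
    unfolding local by (simp add: minimizer_def reflected_quadratic_def)
qed

theorem corollary5p4:
  shows "\<exists>c>0. \<exists>chi0 \<kappa>0. \<exists>\<epsilon>0>0. \<forall>n::nat. n \<ge> 1 \<longrightarrow> (\<forall>chi\<ge>1. \<forall>\<kappa>b\<ge>1.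
    \<exists>\<kappa>s>0. \<exists>m G W (f :: nat \<Rightarrow> nat \<Rightarrow> ell2 \<Rightarrow> real) xstar.
      decentralized_problem n chi \<kappa>b \<kappa>s m G W f \<and>
      minimizer (\<lambda>x. \<Sum>i<m. local_objective n f i x) xstar \<and>
      (chi \<ge> chi0 \<and> \<kappa>b \<ge> \<kappa>0 \<longrightarrow>
        (\<forall>\<epsilon> comm H Q out K.
          0 < \<epsilon> \<and> \<epsilon> < \<epsilon>0 \<and> first_order_run n m G f comm H Q out \<and>
          (\<forall>i<m. \<exists>k\<le>K. eps_solution \<epsilon> xstar (out i k)) \<longrightarrow>
            real (comm_count comm K) \<ge> c * (chi * sqrt \<kappa>b * ln (1 / \<epsilon>)) \<and>
            (\<exists>i<m. infinite (oracle_calls comm Q i K) \<or>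
               real (card (oracle_calls comm Q i K))
                 \<ge> c * ((real n + sqrt (real n * \<kappa>s)) * ln (1 / \<epsilon>))))))"
proof (rule exI[of _ "1 / 48"], rule conjI, simp, rule exI[of _ 6], rule exI[of _ 36],
    rule exI[of _ "exp (-4)"], rule conjI, simp, intro allI impI)
  fix n :: nat and chi \<kappa>b :: real
  assume n: "1 \<le> n" and chi: "1 \<le> chi" and \<kappa>b: "1 \<le> \<kappa>b"
  let ?goal = "\<lambda>\<kappa>s m G W f xstar.
      decentralized_problem n chi \<kappa>b \<kappa>s m G W f \<and>
      minimizer (\<lambda>x. \<Sum>i<m. local_objective n f i x) xstar \<and>
      (chi \<ge> 6 \<and> \<kappa>b \<ge> 36 \<longrightarrow>
        (\<forall>\<epsilon> comm H Q out K.
          0 < \<epsilon> \<and> \<epsilon> < exp (-4) \<and> first_order_run n m G f comm H Q out \<and>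
          (\<forall>i<m. \<exists>k\<le>K. eps_solution \<epsilon> xstar (out i k)) \<longrightarrow>
            real (comm_count comm K) \<ge> 1 / 48 * (chi * sqrt \<kappa>b * ln (1 / \<epsilon>)) \<and>
            (\<exists>i<m. infinite (oracle_calls comm Q i K) \<or>
               real (card (oracle_calls comm Q i K))
                 \<ge> 1 / 48 * ((real n + sqrt (real n * \<kappa>s)) * ln (1 / \<epsilon>)))))"
  show "\<exists>\<kappa>s>0. \<exists>m G W (f :: nat \<Rightarrow> nat \<Rightarrow> ell2 \<Rightarrow> real) xstar. ?goal \<kappa>s m G W f xstar"
  proof (cases "chi \<ge> 6 \<and> \<kappa>b \<ge> 36")
    case False
    then have "?goal 1 2 (\<lambda>_. star_graph 2 0) (\<lambda>_. star_weights 2 0) (\<lambda>_ _. reflected_quadratic id 1 0 0) 0"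
      using trivial_problem[OF n chi \<kappa>b] by blast
    then show ?thesis using zero_less_one by blast
  next
    case True
    \<comment> \<open>The decay \<open>1 - q\<close> of order \<open>1 / r\<close> is what the condition number allows; with the constant \<open>3\<close>
      the two end nodes have condition number about \<open>2 * \<kappa>b / 3\<close>.\<close>
    define r where "r = sqrt \<kappa>b"
    define q where "q = 1 - 3 / r"
    define M where "M = nat \<lfloor>chi\<rfloor> - 2"
    have \<kappa>b_r: "\<kappa>b = r\<^sup>2" using True by (simp add: r_def)
    have "sqrt (6\<^sup>2) \<le> r"
      unfolding r_def by (rule real_sqrt_le_mono) (use True in simp)
    then have r: "6 \<le> r" by simp
    have "6 \<le> \<lfloor>chi\<rfloor>" using True by (simp add: le_floor_iff)
    then have "M + 2 = nat \<lfloor>chi\<rfloor>" "0 < M" "0 \<le> \<lfloor>chi\<rfloor>" unfolding M_def by linarith+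
    then have M2: "real (M + 2) = of_int \<lfloor>chi\<rfloor>" "0 < M" by simp_all
    have M_chi: "real (M + 2) \<le> chi" "chi / 2 \<le> real M"
      using True M2 floor_correct[of chi] by linarith+
    have q: "0 < q" "q < 1" using r by (auto simp: q_def field_simps)
    interpret hard_instance n M q
      by unfold_locales (use n M2 q in auto)
    let ?G = "\<lambda>t. star_graph (M + 2) (rotating_center t)"
    let ?W = "\<lambda>t. star_weights (M + 2) (rotating_center t)"

    have "path_weight = 3 * q / (3 / r)\<^sup>2"
      unfolding path_weight_def by (simp add: q_def)
    also have "\<dots> = r\<^sup>2 / 3 * (1 - 3 / r)"
      by (simp add: q_def power_divide)
    finally have "1 + 2 * path_weight = 1 + 2 * r\<^sup>2 / 3 * (1 - 3 / r)" by simp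
    also have "\<dots> \<le> 1 + 2 * r\<^sup>2 / 3 * 1"
      using r by (intro add_left_mono mult_left_mono) auto
    also have "\<dots> \<le> \<kappa>b" using True by (simp add: \<kappa>b_r)
    finally have "decentralized_problem n chi \<kappa>b (real n * \<kappa>b) (M + 2) ?G ?W f"
      by (intro decentralized M_chi rotating_center_less)
    moreover note minimizer_geometric_blocks
    moreover
    {
      fix \<epsilon> comm H Q out K
      assume \<epsilon>: "0 < \<epsilon>" "\<epsilon> < exp (-4)" and run: "first_order_run n (M + 2) ?G f comm H Q out"
        and sol: "\<forall>i<M + 2. \<exists>k\<le>K. eps_solution \<epsilon> (geometric_blocks n q) (out i k)"
      obtain k where k: "k \<le> K" "eps_solution \<epsilon> (geometric_blocks n q) (out 0 k)"
        using sol by auto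
      let ?L = "ln (1 / \<epsilon>)"
      have "ln \<epsilon> < - 4" using \<epsilon> ln_less_cancel_iff[of \<epsilon> "exp (-4)"] by simp
      then have L: "4 < ?L" using \<epsilon>(1) by (simp add: ln_div)
      have lnq: "ln (1 / q) \<le> 6 / r"
      proof -
        have t: "0 \<le> 3 / r" "3 / r \<le> 1 / 2" using r by (auto simp: field_simps)
        have "2 * (3 / r)\<^sup>2 \<le> 3 / r"
          using mult_left_mono[OF t(2) t(1)] by (simp add: power2_eq_square)
        then have "- (6 / r) \<le> ln q"
          using ln_one_minus_pos_lower_bound[OF t] unfolding q_def by simp
        then show ?thesis using q by (simp add: ln_div)
      qed
      \<comment> \<open>Both bounds below come out with the constant \<open>1 / 24\<close>; it is halved once more by \<open>chi / 2 \<le> M\<close>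
        in the first and by \<open>1 + r \<le> 2 * r\<close> in the second.\<close>
      have comm: "1 / 48 * (chi * sqrt \<kappa>b * ?L) \<le> real (comm_count comm K)"
      proof -
        let ?T = "real (comm_count comm K)"
        have "?L \<le> 2 * ln (1 / q) * (?T / real M + 1)"
          by (rule communication_lower_bound[OF run \<epsilon>(1) k])
        also have "\<dots> \<le> 2 * (6 / r) * (?T / real M + 1)"
          using lnq by (intro mult_right_mono) auto
        finally have "?L * r \<le> 12 * (?T / real M) + 12"
          using r by (simp add: field_simps)
        moreover have "4 * 6 \<le> ?L * r" using L r by (intro mult_mono) auto
        \<comment> \<open>The thresholds on \<open>\<epsilon>\<close> and \<open>\<kappa>b\<close> absorb the additive constant, the head start that node \<open>0\<close>
          has before any communication.\<close>
        ultimately have "?L * r \<le> 24 * (?T / real M)" by linarith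
        then have "?L * r * real M \<le> 24 * ?T" using M2(2) by (simp add: field_simps)
        moreover have "?L * r * (chi / 2) \<le> ?L * r * real M"
          using M_chi L r by (intro mult_left_mono) auto
        ultimately show ?thesis unfolding r_def[symmetric] by (simp add: mult_ac)
      qed
      have calls: "1 / 48 * ((real n + sqrt (real n * (real n * \<kappa>b))) * ?L)
          \<le> real (card (oracle_calls comm Q 0 K))" if fin: "finite (oracle_calls comm Q 0 K)"
      proof -
        let ?C = "real (card (oracle_calls comm Q 0 K))"
        have "real n * ?L \<le> 4 * ln (1 / q) * ?C"
          by (rule oracle_call_lower_bound[OF run network_stars fin \<epsilon>(1) k])
        also have "\<dots> \<le> 4 * (6 / r) * ?C"
          using lnq by (intro mult_right_mono) auto
        finally have C: "real n * ?L * r \<le> 24 * ?C"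
          using r by (simp add: field_simps)
        have "real n + sqrt (real n * (real n * \<kappa>b)) = real n * (1 + r)"
          using r by (simp add: \<kappa>b_r real_sqrt_mult algebra_simps)
        also have "\<dots> \<le> real n * (2 * r)" using r by (intro mult_left_mono) auto
        finally have "(real n + sqrt (real n * (real n * \<kappa>b))) * ?L \<le> real n * (2 * r) * ?L"
          using L by (intro mult_right_mono) auto
        also have "\<dots> = 2 * (real n * ?L * r)" by simp
        finally show ?thesis using C by simp
      qed
      have "1 / 48 * (chi * sqrt \<kappa>b * ?L) \<le> real (comm_count comm K) \<and>
        (\<exists>i<M + 2. infinite (oracle_calls comm Q i K) \<or>
           1 / 48 * ((real n + sqrt (real n * (real n * \<kappa>b))) * ?L) \<le> real (card (oracle_calls comm Q i K)))"
        using comm calls by (intro conjI exI[of _ 0]) auto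
    }
    ultimately have "?goal (real n * \<kappa>b) (M + 2) ?G ?W f (geometric_blocks n q)"
      by blast
    moreover have "0 < real n * \<kappa>b" using n \<kappa>b by simp
    ultimately show ?thesis by blast
  qed
qed

end
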